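(* Let $t$ be a trace of $k\ge 2$ processes, of length $n$. There exists a sound algorithm that requires $O(n^4\cdot\log n)$ time and soundly reports predictable races of $t$ (every pair it reports is a predictable race of $t$). If $k=2$, the algorithm is also complete (i.e. it reports all predictable races of $t$).
   Context: **Events.** There are $k$ processes, a set of global variables and a set of locks. Each event $e$ belongs to one process $p(e)$, accesses one location $\mathsf{loc}(e)$, and is of exactly one of four types: a write $w(x)$ or read $r(x)$ of a global variable $x$, or an acquire $\mathsf{acq}(\ell)$ or release $\mathsf{rel}(\ell)$ of a lock $\ell$. Two distinct read/write events are *conflicting* if they access the same global variable and at least one is a write. **Event sequences.** Let $t$ be a finite sequence of distinct events. $\mathcal{E}(t)$ is its set of events; $e_1<_t e_2$ means that $e_1$ appears before $e_2$ in $t$; $t|q$ is the subsequence of events of process $q$; $\circ$ is concatenation. For an acquire event $a$ of $t$, $\mathsf{match}_t(a)$ is the earliest release event $\rho$ of $t$ on the same lock with $a<_t\rho$ ($\bot$ if there is none); if it exists it is required to belong to $p(a)$. For a release event $\rho$, $\mathsf{match}_t(\rho)$ is the acquire event $a$ with $\mathsf{match}_t(a)=\rho$, which is required to exist. **Traces.** $t$ is a *trace* if (1) for every read $r$ of $t$ there is a write $w$ of $t$ with $\mathsf{loc}(w)=\mathsf{loc}(r)$ and $w<_t r$; and (2) for any two acquires $a_1<_t a_2$ of $t$ on the same lock, $\mathsf{match}_t(a_1)$ exists in $t$ and $\mathsf{match}_t(a_1)<_t a_2$. The *observation function* $\mathcal{O}_t$ maps each read $r$ of $t$ to the last write to $\mathsf{loc}(r)$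 preceding $r$ in $t$. Standing assumption: the input trace $t$ starts with a write event to every global variable. A trace $t'$ is a *correct reordering* of $t$ if $t'|q$ is a prefix of $t|q$ for every process $q$, and $\mathcal{O}_{t'}(r)=\mathcal{O}_t(r)$ for every read $r$ of $t'$. **Predictable races.** For conflicting read/write events $e_1,e_2\in\mathcal{E}(t)$, the (unordered) pair $(e_1,e_2)$ is a *predictable race* of $t$ if $p(e_1)\ne p(e_2)$ and there is a correct reordering $t'$ of $t$ such that $e_1$ and $e_2$ are the next events of their processes after $t'$ (i.e. $(t'|p(e_i))\circ e_i$ is a prefix of $t|p(e_i)$ for $i=1,2$) and $t'\circ e_1\circ e_2$ or $t'\circ e_2\circ e_1$ is a trace. **Complexity conventions.** The number of processes $k$ and the number of variables and locks are treated as constants in the $O$-notation (the hidden dependency on them is polynomial, of order $k^2$ times the number of variables). *)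

theory Defs
  imports Complex_Main "HOL-Library.Sublist" "HOL-Library.Landau_Symbols"
begin

section \<open>Events and traces\<close>

datatype location = Var nat | Lock nat

datatype action =
    is_Write: Write nat
  | is_Read: Read nat
  | is_Acquire: Acquire nat
  | is_Release: Release nat

text \<open>The component \<open>eid\<close> only serves to tell apart events that perform the same action
  in the same process.\<close>

datatype event = Event (eid: nat) (proc: nat) (action: action)

fun loc_of :: "action \<Rightarrow> location" where
  "loc_of (Write x) = Var x"
| "loc_of (Read x) = Var x"
| "loc_of (Acquire l) = Lock l"
| "loc_of (Release l) = Lock l"

abbreviation loc :: "event \<Rightarrow> location" where
  "loc e \<equiv> loc_of (action e)"

abbreviation "writes e \<equiv> is_Write (action e)"
abbreviation "reads e \<equiv> is_Read (action e)"
abbreviation "acquires e \<equiv> is_Acquire (action e)"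
abbreviation "releases e \<equiv> is_Release (action e)"

definition conflicting :: "event \<Rightarrow> event \<Rightarrow> bool" where
  "conflicting e1 e2 \<longleftrightarrow>
     e1 \<noteq> e2 \<and> (writes e1 \<or> reads e1) \<and> (writes e2 \<or> reads e2) \<and>
     loc e1 = loc e2 \<and> (writes e1 \<or> writes e2)"

definition before :: "event list \<Rightarrow> event \<Rightarrow> event \<Rightarrow> bool" where
  "before t e1 e2 \<longleftrightarrow> (\<exists>i j. i < j \<and> j < length t \<and> t ! i = e1 \<and> t ! j = e2)"

definition proj :: "nat \<Rightarrow> event list \<Rightarrow> event list" where
  "proj q t = filter (\<lambda>e. proc e = q) t"

text \<open>For an acquire event of \<open>t\<close>; \<open>None\<close> means that there is no matching release.\<close>

definition match_acq :: "event list \<Rightarrow> event \<Rightarrow> event option" where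
  "match_acq t a =
     find (\<lambda>r. releases r \<and> loc r = loc a) (tl (dropWhile (\<lambda>e. e \<noteq> a) t))"

text \<open>The requirements that come with the notion of matching events: a matching release
  belongs to the process of its acquire, and every release matches some acquire.\<close>

definition locks_matched :: "event list \<Rightarrow> bool" where
  "locks_matched t \<longleftrightarrow>
     (\<forall>a \<in> set t. acquires a \<longrightarrow> (\<forall>r. match_acq t a = Some r \<longrightarrow> proc r = proc a)) \<and>
     (\<forall>r \<in> set t. releases r \<longrightarrow> (\<exists>a \<in> set t. acquires a \<and> match_acq t a = Some r))"

definition is_trace :: "event list \<Rightarrow> bool" where
  "is_trace t \<longleftrightarrow>
     distinct t \<and> locks_matched t \<and>
     (\<forall>r \<in> set t. reads r \<longrightarrow> (\<exists>w \<in> set t. writes w \<and> loc w = loc r \<and> before t w r)) \<and>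
     (\<forall>a1 \<in> set t. \<forall>a2 \<in> set t.
        acquires a1 \<and> acquires a2 \<and> loc a1 = loc a2 \<and> before t a1 a2 \<longrightarrow>
        (\<exists>r. match_acq t a1 = Some r \<and> before t r a2))"

text \<open>The observation function; the list is non-empty for every read of a trace.\<close>

definition obs :: "event list \<Rightarrow> event \<Rightarrow> event" where
  "obs t r = last (filter (\<lambda>w. writes w \<and> loc w = loc r) (takeWhile (\<lambda>e. e \<noteq> r) t))"

definition correct_reordering :: "event list \<Rightarrow> event list \<Rightarrow> bool" where
  "correct_reordering t t' \<longleftrightarrow>
     is_trace t' \<and> (\<forall>q. prefix (proj q t') (proj q t)) \<and>
     (\<forall>r \<in> set t'. reads r \<longrightarrow> obs t' r = obs t r)"

definition predictable_race :: "event list \<Rightarrow> event \<Rightarrow> event \<Rightarrow> bool" where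
  "predictable_race t e1 e2 \<longleftrightarrow>
     e1 \<in> set t \<and> e2 \<in> set t \<and> conflicting e1 e2 \<and> proc e1 \<noteq> proc e2 \<and>
     (\<exists>t'. correct_reordering t t' \<and>
           prefix (proj (proc e1) t' @ [e1]) (proj (proc e1) t) \<and>
           prefix (proj (proc e2) t' @ [e2]) (proj (proc e2) t) \<and>
           (is_trace (t' @ [e1, e2]) \<or> is_trace (t' @ [e2, e1])))"

text \<open>The input traces, over the processes, global variables and locks numbered below
  \<open>k\<close>, \<open>V\<close> and \<open>L\<close>. They start with a block of writes that covers all global variables.\<close>

definition input_trace :: "nat \<Rightarrow> nat \<Rightarrow> nat \<Rightarrow> event list \<Rightarrow> bool" where
  "input_trace k V L t \<longleftrightarrow>
     is_trace t \<and>
     (\<forall>e \<in> set t. proc e < k \<and> loc e \<in> Var ` {..<V} \<union> Lock ` {..<L}) \<and>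
     (\<exists>u v. t = u @ v \<and> (\<forall>e \<in> set u. writes e) \<and> (\<forall>x < V. \<exists>e \<in> set u. loc e = Var x))"


section \<open>Algorithms and their running time\<close>

text \<open>
  Algorithms are programs of a word RAM with unit cost, in structured form. A program uses
  finitely many registers and an indirectly addressed memory, and appends pairs of numbers to
  an output list. Every instruction and every evaluation of a branching condition costs one
  time unit. Every number moved into a register has to be below the bound \<open>W\<close> of the machine
  (words have \<open>log 2 W\<close> bits); an instruction that would exceed it cannot be executed.
\<close>

datatype binop = Plus | Minus | Times | Div | Mod

fun binop_val :: "binop \<Rightarrow> nat \<Rightarrow> nat \<Rightarrow> nat" where
  "binop_val Plus a b = a + b"
| "binop_val Minus a b = a - b"
| "binop_val Times a b = a * b"
| "binop_val Div a b = a div b"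
| "binop_val Mod a b = a mod b"

datatype com =
    Skip
  | Const nat nat
  | Arith binop nat nat nat
  | Load nat nat
  | Store nat nat
  | Report nat nat
  | Seq com com
  | IfLess nat nat com com
  | WhileLess nat nat com

record state =
  reg :: "nat \<Rightarrow> nat"
  mem :: "nat \<Rightarrow> nat"
  out :: "(nat \<times> nat) list"

text \<open>\<open>exec W c s \<tau> s'\<close>: started in \<open>s\<close>, the program \<open>c\<close> terminates in \<open>s'\<close> after \<open>\<tau>\<close> time units.\<close>

inductive exec :: "nat \<Rightarrow> com \<Rightarrow> state \<Rightarrow> nat \<Rightarrow> state \<Rightarrow> bool" for W where
  Skip: "exec W Skip s 1 s"
| Const: "v < W \<Longrightarrow> exec W (Const r v) s 1 (s\<lparr>reg := (reg s)(r := v)\<rparr>)"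
| Arith: "v = binop_val f (reg s a) (reg s b) \<Longrightarrow> v < W \<Longrightarrow>
    exec W (Arith f r a b) s 1 (s\<lparr>reg := (reg s)(r := v)\<rparr>)"
| Load: "v = mem s (reg s a) \<Longrightarrow> v < W \<Longrightarrow>
    exec W (Load r a) s 1 (s\<lparr>reg := (reg s)(r := v)\<rparr>)"
| Store: "exec W (Store a b) s 1 (s\<lparr>mem := (mem s)(reg s a := reg s b)\<rparr>)"
| Report: "exec W (Report a b) s 1 (s\<lparr>out := out s @ [(reg s a, reg s b)]\<rparr>)"
| Seq: "exec W c1 s m s' \<Longrightarrow> exec W c2 s' n s'' \<Longrightarrow> exec W (Seq c1 c2) s (m + n) s''"
| IfTrue: "reg s a < reg s b \<Longrightarrow> exec W c1 s m s' \<Longrightarrow>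
    exec W (IfLess a b c1 c2) s (Suc m) s'"
| IfFalse: "\<not> reg s a < reg s b \<Longrightarrow> exec W c2 s m s' \<Longrightarrow>
    exec W (IfLess a b c1 c2) s (Suc m) s'"
| WhileFalse: "\<not> reg s a < reg s b \<Longrightarrow> exec W (WhileLess a b c) s 1 s"
| WhileTrue: "reg s a < reg s b \<Longrightarrow> exec W c s m s' \<Longrightarrow> exec W (WhileLess a b c) s' n s'' \<Longrightarrow>
    exec W (WhileLess a b c) s (Suc (m + n)) s''"

inductive_cases exec_elims:
  "exec W Skip s n s'"
  "exec W (Const r v) s n s'"
  "exec W (Arith f r a b) s n s'"
  "exec W (Load r a) s n s'"
  "exec W (Store a b) s n s'"
  "exec W (Report a b) s n s'"
  "exec W (Seq c1 c2) s n s'"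
  "exec W (IfLess a b c1 c2) s n s'"

inductive_cases exec_WhileE: "exec W (WhileLess a b c) s n s'"

text \<open>Programs are deterministic, so an existing execution is the only one.\<close>

lemma exec_deterministic:
  "exec W c s m s1 \<Longrightarrow> exec W c s n s2 \<Longrightarrow> m = n \<and> s1 = s2"
proof (induction arbitrary: n s2 rule: exec.induct)
  case (Skip s)
  from Skip.prems show ?case by (rule exec_elims(1)) simp
next
  case (Const v r s)
  from Const.prems show ?case by (rule exec_elims(2)) simp
next
  case (Arith v f s a b r)
  from Arith.prems show ?case by (rule exec_elims(3)) (simp add: Arith.hyps(1))
next
  case (Load v s a r)
  from Load.prems show ?case by (rule exec_elims(4)) (simp add: Load.hyps(1))
next
  case (Store a b s)
  from Store.prems show ?case by (rule exec_elims(5)) simp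
next
  case (Report a b s)
  from Report.prems show ?case by (rule exec_elims(6)) simp
next
  case (Seq c1 s m s' c2 k s'')
  from Seq.prems show ?case
  proof (rule exec_elims(7))
    fix m' u k'
    assume *: "n = m' + k'" "exec W c1 s m' u" "exec W c2 u k' s2"
    have "m = m' \<and> s' = u" using Seq.IH(1) *(2) .
    with Seq.IH(2) *(1,3) show ?thesis by blast
  qed
next
  case (IfTrue s a b c1 m s' c2)
  from IfTrue.prems show ?case
  proof (rule exec_elims(8))
    fix m' assume "n = Suc m'" "exec W c1 s m' s2"
    with IfTrue.IH show ?thesis by blast
  qed (simp add: IfTrue.hyps(1))
next
  case (IfFalse s a b c2 m s' c1)
  from IfFalse.prems show ?case
  proof (rule exec_elims(8))
    fix m' assume "n = Suc m'" "exec W c2 s m' s2"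
    with IfFalse.IH show ?thesis by blast
  qed (simp add: IfFalse.hyps(1))
next
  case (WhileFalse s a b c)
  from WhileFalse.prems show ?case
    by (rule exec_WhileE) (simp_all add: WhileFalse.hyps)
next
  case (WhileTrue s a b c m s' k s'')
  from WhileTrue.prems show ?case
  proof (rule exec_WhileE)
    fix m' u k'
    assume *: "n = Suc (m' + k')" "exec W c s m' u" "exec W (WhileLess a b c) u k' s2"
    have "m = m' \<and> s' = u" using WhileTrue.IH(1) *(2) .
    with WhileTrue.IH(2) *(1,3) show ?thesis by blast
  qed (simp add: WhileTrue.hyps(1))
qed

text \<open>
  The input: memory contains \<open>k\<close>, \<open>V\<close>, \<open>L\<close>, the length of the trace, and then for each event
  its process, its type and the number of its variable or lock. All other cells, and
  all registers, are zero. The program may use words of \<open>O(log N)\<close> bits, where \<open>N\<close> is the sum of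
  the length of the trace and the numbers of processes, variables and locks.
\<close>

fun encode_action :: "action \<Rightarrow> nat list" where
  "encode_action (Write x) = [0, x]"
| "encode_action (Read x) = [1, x]"
| "encode_action (Acquire l) = [2, l]"
| "encode_action (Release l) = [3, l]"

definition encode_input :: "nat \<Rightarrow> nat \<Rightarrow> nat \<Rightarrow> event list \<Rightarrow> nat list" where
  "encode_input k V L t =
     [k, V, L, length t] @ concat (map (\<lambda>e. proc e # encode_action (action e)) t)"

definition initial_state :: "nat \<Rightarrow> nat \<Rightarrow> nat \<Rightarrow> event list \<Rightarrow> state" where
  "initial_state k V L t =
     (let xs = encode_input k V L t
      in \<lparr>reg = (\<lambda>_. 0), mem = (\<lambda>i. if i < length xs then xs ! i else 0), out = []\<rparr>)"

definition word_bound :: "nat \<Rightarrow> nat \<Rightarrow> nat \<Rightarrow> nat \<Rightarrow> event list \<Rightarrow> nat" where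
  "word_bound d k V L t = (length t + k + V + L + 2) ^ d"

text \<open>\<open>computes_in A d k V L t b R\<close>: on input \<open>t\<close> and with word size parameter \<open>d\<close>, the program \<open>A\<close>
  terminates within time \<open>b\<close>, having output the list \<open>R\<close>.\<close>

definition computes_in ::
    "com \<Rightarrow> nat \<Rightarrow> nat \<Rightarrow> nat \<Rightarrow> nat \<Rightarrow> event list \<Rightarrow> real \<Rightarrow> (nat \<times> nat) list \<Rightarrow> bool" where
  "computes_in A d k V L t b R \<longleftrightarrow>
     (\<exists>\<tau> s. exec (word_bound d k V L t) A (initial_state k V L t) \<tau> s \<and>
            real \<tau> \<le> b \<and> out s = R)"

text \<open>An algorithm reports a pair of events by the positions of the two events in \<open>t\<close>.\<close>

definition sound_report :: "event list \<Rightarrow> (nat \<times> nat) list \<Rightarrow> bool" where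
  "sound_report t R \<longleftrightarrow>
     (\<forall>(i, j) \<in> set R. i < length t \<and> j < length t \<and> predictable_race t (t ! i) (t ! j))"

definition complete_report :: "event list \<Rightarrow> (nat \<times> nat) list \<Rightarrow> bool" where
  "complete_report t R \<longleftrightarrow>
     (\<forall>i < length t. \<forall>j < length t. predictable_race t (t ! i) (t ! j) \<longrightarrow>
        (i, j) \<in> set R \<or> (j, i) \<in> set R)"

end

theory Submission
  imports Defs
begin

text \<open>
  With two processes, a correct reordering that makes two events of different processes the next
  ones consists of exactly the events before them in their processes. So it is a path through
  the pairs of prefixes of the two processes, and all conditions on it are local to its steps: a
  read may be executed once the write it has to observe has been executed; a write may be executed
  unless it would overwrite a value that some read of the target set still has to observe; an
  acquire may be executed while nobody holds the lock. Only the condition on writes depends on the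
  target, and it does so monotonically: each step has two thresholds for the two components of the
  targets for which it may be used. They are tabulated once in time \<open>O(n^3)\<close>; reachability
  of a target is then decided by dynamic programming in time \<open>O(n^2)\<close>.
  For more than two processes the program reports nothing, which is sound.
\<close>

section \<open>Locks\<close>

text \<open>Testing each write afresh for every target would cost O(n) for each of n^2 targets and
  n^2 pairs, O(n^5) in all; the table avoids this. Two further facts keep the steps local. The set
  executed at a pair does not depend on the interleaving, so the pair is a sufficient state. And
  matching of lock events, which looks arbitrarily far ahead, is replaced by alternation of acquires
  and releases on each lock, so that whether a lock is free becomes a parity. Releases need no test
  at all, since the order within their process already supplies the open acquire. The two racing
  events cost nothing either: they only have to extend the reordering to a trace, not to a correct
  reordering, so placing a write first always succeeds. With more processes the target no longer
  fixes how far the remaining processes have run, and the argument stops there.\<close>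

fun alternating :: "event list \<Rightarrow> bool" where
  "alternating [] \<longleftrightarrow> True"
| "alternating [a] \<longleftrightarrow> acquires a"
| "alternating (a # r # es) \<longleftrightarrow>
     acquires a \<and> releases r \<and> proc r = proc a \<and> alternating es"

definition locks_ok :: "event list \<Rightarrow> bool" where
  "locks_ok u \<longleftrightarrow> locks_matched u \<and>
     (\<forall>a1 \<in> set u. \<forall>a2 \<in> set u.
        acquires a1 \<and> acquires a2 \<and> loc a1 = loc a2 \<and> before u a1 a2 \<longrightarrow>
        (\<exists>r. match_acq u a1 = Some r \<and> before u r a2))"

abbreviation on :: "location \<Rightarrow> event list \<Rightarrow> event list" where
  "on l u \<equiv> filter (\<lambda>e. loc e = l) u"

section \<open>Order and matching under restriction of a sequence\<close>

lemma before_Nil [simp]: "\<not> before [] a b"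
  by (simp add: before_def)

lemma before_Cons: "before (x # u) a b \<longleftrightarrow> x = a \<and> b \<in> set u \<or> before u a b"
proof
  assume "before (x # u) a b"
  then obtain i j where ij: "i < j" "j < length (x # u)" "(x # u) ! i = a" "(x # u) ! j = b"
    unfolding before_def by blast
  then obtain j' where j': "j = Suc j'" by (cases j) auto
  show "x = a \<and> b \<in> set u \<or> before u a b"
  proof (cases i)
    case 0
    then show ?thesis using ij j' by auto
  next
    case (Suc i')
    then have "before u a b"
      unfolding before_def using ij j' by (intro exI[of _ i'] exI[of _ j']) auto
    then show ?thesis ..
  qed
next
  assume "x = a \<and> b \<in> set u \<or> before u a b"
  then show "before (x # u) a b"
  proof
    assume *: "x = a \<and> b \<in> set u"
    then obtain j where "j < length u" "u ! j = b" by (auto simp: in_set_conv_nth)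
    with * show ?thesis
      unfolding before_def by (intro exI[of _ 0] exI[of _ "Suc j"]) auto
  next
    assume "before u a b"
    then obtain i j where "i < j" "j < length u" "u ! i = a" "u ! j = b"
      unfolding before_def by blast
    then show ?thesis
      unfolding before_def by (intro exI[of _ "Suc i"] exI[of _ "Suc j"]) auto
  qed
qed

lemma before_in_set: "before u a b \<Longrightarrow> a \<in> set u \<and> b \<in> set u"
  by (induction u) (auto simp: before_Cons)

lemma before_filter: "P a \<Longrightarrow> P b \<Longrightarrow> before (filter P u) a b \<longleftrightarrow> before u a b"
  by (induction u) (auto simp: before_Cons)

lemma before_append: "before (u @ v) a b \<longleftrightarrow> before u a b \<or> before v a b \<or> a \<in> set u \<and> b \<in> set v"
  by (induction u) (auto simp: before_Cons)

lemma match_acq_Nil [simp]: "match_acq [] a = None"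
  by (simp add: match_acq_def)

lemma match_acq_Cons:
  "match_acq (x # u) a =
     (if x = a then find (\<lambda>r. releases r \<and> loc r = loc a) u else match_acq u a)"
  by (simp add: match_acq_def)

lemma find_filter: "(\<And>x. P x \<Longrightarrow> Q x) \<Longrightarrow> find P (filter Q u) = find P u"
  by (induction u) auto

lemma match_acq_on: "match_acq (on (loc a) u) a = match_acq u a"
proof (induction u)
  case (Cons x u)
  have "find (\<lambda>r. releases r \<and> loc r = loc a) (on (loc a) u) =
        find (\<lambda>r. releases r \<and> loc r = loc a) u"
    by (rule find_filter) simp
  with Cons show ?case by (auto simp: match_acq_Cons)
qed simp

lemma match_acq_SomeD:
  "match_acq u a = Some r \<Longrightarrow> releases r \<and> loc r = loc a \<and> before u a r"
  by (induction u)
     (auto simp: match_acq_Cons before_Cons find_Some_iff split: if_splits)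

lemma locks_okI:
  assumes "\<And>a r. a \<in> set u \<Longrightarrow> acquires a \<Longrightarrow> match_acq u a = Some r \<Longrightarrow> proc r = proc a"
    and "\<And>r. r \<in> set u \<Longrightarrow> releases r \<Longrightarrow> \<exists>a \<in> set u. acquires a \<and> match_acq u a = Some r"
    and "\<And>a1 a2. acquires a1 \<Longrightarrow> acquires a2 \<Longrightarrow> loc a1 = loc a2 \<Longrightarrow> before u a1 a2 \<Longrightarrow>
      \<exists>r. match_acq u a1 = Some r \<and> before u r a2"
  shows "locks_ok u"
  using assms unfolding locks_ok_def locks_matched_def by simp

lemma locks_ok_proc:
  "locks_ok u \<Longrightarrow> a \<in> set u \<Longrightarrow> acquires a \<Longrightarrow> match_acq u a = Some r \<Longrightarrow> proc r = proc a"
  unfolding locks_ok_def locks_matched_def by simp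

lemma locks_ok_release:
  "locks_ok u \<Longrightarrow> r \<in> set u \<Longrightarrow> releases r \<Longrightarrow> \<exists>a \<in> set u. acquires a \<and> match_acq u a = Some r"
  unfolding locks_ok_def locks_matched_def by simp

lemma locks_ok_acquires:
  "locks_ok u \<Longrightarrow> acquires a1 \<Longrightarrow> acquires a2 \<Longrightarrow> loc a1 = loc a2 \<Longrightarrow> before u a1 a2 \<Longrightarrow>
    \<exists>r. match_acq u a1 = Some r \<and> before u r a2"
  using before_in_set[of u a1 a2] unfolding locks_ok_def by simp

lemma before_on: "loc a = l \<Longrightarrow> loc b = l \<Longrightarrow> before (on l u) a b \<longleftrightarrow> before u a b"
  by (rule before_filter)

text \<open>Each requirement relates events of one location only, and \<open>match_acq\<close> looks
  for a release on the lock of its acquire. So the lock discipline can be checked one location at a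
  time.\<close>

lemma locks_ok_on: "locks_ok u \<longleftrightarrow> (\<forall>l. locks_ok (on l u))"
proof
  assume ok: "locks_ok u"
  show "\<forall>l. locks_ok (on l u)"
  proof
    fix l
    have m: "match_acq (on l u) a = match_acq u a" if "loc a = l" for a
      using match_acq_on[of a u] that by simp
    show "locks_ok (on l u)"
    proof (rule locks_okI)
      fix a r assume "a \<in> set (on l u)" "acquires a" "match_acq (on l u) a = Some r"
      then show "proc r = proc a" using locks_ok_proc[OF ok, of a r] m[of a] by simp
    next
      fix r assume r: "r \<in> set (on l u)" "releases r"
      then obtain a where a: "a \<in> set u" "acquires a" "match_acq u a = Some r"
        using locks_ok_release[OF ok, of r] by auto
      then have "loc a = l" using match_acq_SomeD[OF a(3)] r by simp
      then show "\<exists>a\<in>set (on l u). acquires a \<and> match_acq (on l u) a = Some r"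
        using a m[of a] by auto
    next
      fix a1 a2
      assume a: "acquires a1" "acquires a2" "loc a1 = loc a2" "before (on l u) a1 a2"
      have l: "loc a1 = l" "loc a2 = l" using before_in_set[OF a(4)] by simp_all
      then have "before u a1 a2" using a(4) before_on by blast
      then obtain r where r: "match_acq u a1 = Some r" "before u r a2"
        using locks_ok_acquires[OF ok a(1-3)] by blast
      then have "before (on l u) r a2"
        using match_acq_SomeD[OF r(1)] l by (simp add: before_on)
      then show "\<exists>r. match_acq (on l u) a1 = Some r \<and> before (on l u) r a2"
        using r m[OF l(1)] by auto
    qed
  qed
next
  assume ok: "\<forall>l. locks_ok (on l u)"
  note m = match_acq_on[of _ u]
  show "locks_ok u"
  proof (rule locks_okI)
    fix a r assume "a \<in> set u" "acquires a" "match_acq u a = Some r"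
    then show "proc r = proc a"
      using locks_ok_proc[OF ok[rule_format, of "loc a"], of a r] m[of a] by simp
  next
    fix r assume "r \<in> set u" "releases r"
    then obtain a where "a \<in> set u" "loc a = loc r" "acquires a" "match_acq (on (loc r) u) a = Some r"
      using locks_ok_release[OF ok[rule_format, of "loc r"], of r] by auto
    then show "\<exists>a\<in>set u. acquires a \<and> match_acq u a = Some r"
      using m[of a] by auto
  next
    fix a1 a2 assume a: "acquires a1" "acquires a2" "loc a1 = loc a2" "before u a1 a2"
    have "before (on (loc a1) u) a1 a2" using a(3,4) by (simp add: before_on)
    then obtain r where r: "match_acq (on (loc a1) u) a1 = Some r" "before (on (loc a1) u) r a2"
      using locks_ok_acquires[OF ok[rule_format, of "loc a1"] a(1-3)] by blast
    have "loc r = loc a1" using before_in_set[OF r(2)] by simp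
    then have "before u r a2" using r(2) a(3) by (simp add: before_on)
    then show "\<exists>r. match_acq u a1 = Some r \<and> before u r a2" using r(1) m[of a1] by auto
  qed
qed

lemma on_lock_cases:
  assumes "loc e = Lock l"
  shows "acquires e \<and> \<not> releases e \<or> \<not> acquires e \<and> releases e"
  using assms by (cases "action e") auto

text \<open>A release in front would have no earlier acquire to match, so \<open>x\<close> is an
  acquire. A second acquire \<open>y\<close> would need the release of \<open>x\<close> strictly
  before it, where only \<open>x\<close> itself stands, so \<open>y\<close> is a release and matches
  \<open>x\<close>. By distinctness the matches inside \<open>es\<close> are not affected by the two
  events in front.\<close>

lemma locks_ok_Cons_Cons:
  assumes "x \<noteq> y" "x \<notin> set es" "y \<notin> set es" "distinct es"
    and l: "loc x = Lock l" "loc y = Lock l" "\<And>e. e \<in> set es \<Longrightarrow> loc e = Lock l"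
  shows "locks_ok (x # y # es) \<longleftrightarrow>
    acquires x \<and> releases y \<and> proc y = proc x \<and> locks_ok es"
proof -
  let ?u = "x # y # es"
  note d = assms(1-4)
  have m: "match_acq ?u a = match_acq es a" if "a \<in> set es" for a
    using that d by (auto simp: match_acq_Cons)
  have bx: "before ?u a x \<longleftrightarrow> False" for a
    using d before_in_set[of es a x] by (auto simp: before_Cons)
  have b_y: "before ?u a y \<longleftrightarrow> a = x" for a
    using d before_in_set[of es a y] by (auto simp: before_Cons)
  have b: "before ?u a c \<longleftrightarrow> before es a c" if "a \<in> set es" for a c
    using that d by (auto simp: before_Cons)
  have b': "before es a c" if "before ?u a c" "a \<noteq> x" "a \<noteq> y" for a c
    using that by (auto simp: before_Cons)
  show ?thesis
  proof
    assume ok: "locks_ok ?u"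
    have ax: "acquires x"
    proof (rule ccontr)
      assume "\<not> acquires x"
      then have "releases x" using on_lock_cases[OF l(1)] by blast
      then obtain a where a: "match_acq ?u a = Some x"
        using locks_ok_release[OF ok, of x] by auto
      from match_acq_SomeD[OF a] bx show False by blast
    qed
    have rx: "\<not> releases x" using ax on_lock_cases[OF l(1)] by blast
    have ry: "releases y"
    proof (rule ccontr)
      assume "\<not> releases y"
      then have "acquires y" using on_lock_cases[OF l(2)] by blast
      moreover have "before ?u x y" by (simp add: before_Cons)
      ultimately obtain r where r: "match_acq ?u x = Some r" "before ?u r y"
        using locks_ok_acquires[OF ok ax, of y] l by auto
      then have "r = x" using b_y by blast
      with match_acq_SomeD[OF r(1)] rx show False by blast
    qed
    have ay: "\<not> acquires y" using ry on_lock_cases[OF l(2)] by blast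
    have mx: "match_acq ?u x = Some y" using ry l by (simp add: match_acq_Cons)
    have "locks_ok es"
    proof (rule locks_okI)
      fix a r assume a: "a \<in> set es" "acquires a" "match_acq es a = Some r"
      then show "proc r = proc a" using locks_ok_proc[OF ok, of a r] m[OF a(1)] by simp
    next
      fix r assume r: "r \<in> set es" "releases r"
      then obtain a where a: "a \<in> set ?u" "acquires a" "match_acq ?u a = Some r"
        using locks_ok_release[OF ok, of r] by auto
      have "a \<noteq> x" using mx a(3) r d by auto
      moreover have "a \<noteq> y" using ay a(2) by auto
      ultimately have "a \<in> set es" using a(1) by auto
      then show "\<exists>a\<in>set es. acquires a \<and> match_acq es a = Some r"
        using a(2,3) m[of a] by auto
    next
      fix a1 a2 assume a: "acquires a1" "acquires a2" "loc a1 = loc a2" "before es a1 a2"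
      have a1: "a1 \<in> set es" using before_in_set[OF a(4)] by blast
      then have "before ?u a1 a2" using b a(4) by blast
      then obtain r where r: "match_acq es a1 = Some r" "before ?u r a2"
        using locks_ok_acquires[OF ok a(1-3)] m[OF a1] by auto
      then have "r \<in> set es" using match_acq_SomeD[OF r(1)] before_in_set by blast
      then show "\<exists>r. match_acq es a1 = Some r \<and> before es r a2" using r b by blast
    qed
    moreover have "proc y = proc x" using locks_ok_proc[OF ok _ ax mx] by simp
    ultimately show "acquires x \<and> releases y \<and> proc y = proc x \<and> locks_ok es"
      using ax ry by blast
  next
    assume *: "acquires x \<and> releases y \<and> proc y = proc x \<and> locks_ok es"
    then have ok: "locks_ok es" and xy: "acquires x" "releases y" "proc y = proc x" by blast+
    have n: "\<not> acquires y" "\<not> releases x"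
      using xy on_lock_cases[OF l(1)] on_lock_cases[OF l(2)] by blast+
    have mx: "match_acq ?u x = Some y" using xy l by (simp add: match_acq_Cons)
    show "locks_ok ?u"
    proof (rule locks_okI)
      fix a r assume a: "a \<in> set ?u" "acquires a" "match_acq ?u a = Some r"
      then consider "a = x" | "a \<in> set es" using n(1) by auto
      then show "proc r = proc a"
      proof cases
        case 1
        then show ?thesis using a(3) mx xy(3) by simp
      next
        case 2
        then show ?thesis using locks_ok_proc[OF ok 2 a(2)] a(3) m by simp
      qed
    next
      fix r assume r: "r \<in> set ?u" "releases r"
      then consider "r = y" | "r \<in> set es" using n(2) by auto
      then show "\<exists>a\<in>set ?u. acquires a \<and> match_acq ?u a = Some r"
      proof cases
        case 1
        then show ?thesis using mx xy by auto
      next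
        case 2
        then obtain a where "a \<in> set es" "acquires a" "match_acq es a = Some r"
          using locks_ok_release[OF ok 2 r(2)] by blast
        then show ?thesis using m[of a] by auto
      qed
    next
      fix a1 a2 assume a: "acquires a1" "acquires a2" "loc a1 = loc a2" "before ?u a1 a2"
      have "a2 \<noteq> x" "a2 \<noteq> y" using a(2,4) bx n(1) by blast+
      then have a2: "a2 \<in> set es" using before_in_set[OF a(4)] by simp
      show "\<exists>r. match_acq ?u a1 = Some r \<and> before ?u r a2"
      proof (cases "a1 = x")
        case True
        have "before ?u y a2" using a2 by (simp add: before_Cons)
        then show ?thesis using True mx by blast
      next
        case False
        have "a1 \<noteq> y" using a(1) n(1) by blast
        then have bf: "before es a1 a2" using b' False a(4) by blast
        then obtain r where r: "match_acq es a1 = Some r" "before es r a2"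
          using locks_ok_acquires[OF ok a(1-3)] by blast
        have "a1 \<in> set es" "r \<in> set es" using before_in_set[OF bf] before_in_set[OF r(2)] by blast+
        then show ?thesis using m b r by auto
      qed
    qed
  qed
qed

text \<open>Unlike \<open>match_acq\<close>, alternation passes obviously to prefixes and to the
  events of one process. Both are needed to transfer the lock discipline between a trace and its
  reorderings.\<close>

lemma locks_ok_iff_alternating:
  assumes "distinct u" "\<And>e. e \<in> set u \<Longrightarrow> loc e = Lock l"
  shows "locks_ok u \<longleftrightarrow> alternating u"
  using assms
proof (induction u rule: alternating.induct)
  case 1
  show ?case by (simp add: locks_ok_def locks_matched_def)
next
  case (2 a)
  then show ?case
    using on_lock_cases[of a l]
    by (auto simp: locks_ok_def locks_matched_def match_acq_Cons before_Cons)
next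
  case (3 x y es)
  then have "locks_ok (x # y # es) \<longleftrightarrow>
    acquires x \<and> releases y \<and> proc y = proc x \<and> locks_ok es"
    by (intro locks_ok_Cons_Cons[where l = l]) auto
  then show ?case using 3 by auto
qed

lemma locks_ok_Var:
  assumes "\<And>e. e \<in> set u \<Longrightarrow> loc e = Var x"
  shows "locks_ok u"
proof -
  have "\<not> acquires e \<and> \<not> releases e" if "e \<in> set u" for e
    using assms[OF that] by (cases "action e") auto
  then show ?thesis by (auto simp: locks_ok_def locks_matched_def)
qed

lemma is_trace_iff:
  "is_trace t \<longleftrightarrow> distinct t \<and> (\<forall>l. alternating (on (Lock l) t)) \<and>
     (\<forall>r \<in> set t. reads r \<longrightarrow> (\<exists>w \<in> set t. writes w \<and> loc w = loc r \<and> before t w r))"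
proof (cases "distinct t")
  case True
  have "locks_ok t \<longleftrightarrow> (\<forall>l. alternating (on (Lock l) t))"
  proof -
    have "locks_ok t \<longleftrightarrow> (\<forall>l. locks_ok (on (Lock l) t))"
    proof
      assume *: "\<forall>l. locks_ok (on (Lock l) t)"
      show "locks_ok t"
        unfolding locks_ok_on[of t]
      proof
        fix l show "locks_ok (on l t)"
        proof (cases l)
          case (Var x)
          show ?thesis by (rule locks_ok_Var[of _ x]) (auto simp: Var)
        qed (use * in auto)
      qed
    qed (use locks_ok_on in blast)
    also have "\<dots> \<longleftrightarrow> (\<forall>l. alternating (on (Lock l) t))"
    proof -
      have "locks_ok (on (Lock l) t) \<longleftrightarrow> alternating (on (Lock l) t)" for l
        by (rule locks_ok_iff_alternating[of _ l]) (use True in auto)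
      then show ?thesis by blast
    qed
    finally show ?thesis .
  qed
  then show ?thesis unfolding is_trace_def locks_ok_def by blast
qed (simp add: is_trace_def)

text \<open>Reorderings are built at the end, while the definition consumes pairs from the front. An
  even length means that the lock is free, an odd one that the process of the last event holds
  it.\<close>

lemma alternating_snoc:
  "alternating (u @ [e]) \<longleftrightarrow> alternating u \<and>
     (if even (length u) then acquires e else releases e \<and> proc e = proc (last u))"
  by (induction u rule: alternating.induct) auto

lemma alternating_append: "alternating (u @ v) \<Longrightarrow> alternating u"
  by (induction v rule: rev_induct) (auto simp: alternating_snoc simp flip: append_assoc)

lemma proj_simps [simp]:
  "proj q [] = []" "proj q (e # u) = (if proc e = q then e # proj q u else proj q u)"
  "proj q (u @ v) = proj q u @ proj q v"
  by (simp_all add: proj_def)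

lemma alternating_proj: "alternating u \<Longrightarrow> alternating (proj q u)"
  by (induction u rule: alternating.induct) auto

text \<open>With even length every acquire is closed by a release of the same process, so a
  projection keeps or drops the two together.\<close>

lemma even_length_proj: "alternating u \<Longrightarrow> even (length u) \<Longrightarrow> even (length (proj q u))"
  by (induction u rule: alternating.induct) auto

text \<open>The surplus of acquires is the parity of the length. This ties the counters in
  \<open>allowed\<close>, which see only a set, to alternation, which is a property of the
  order.\<close>

lemma alternating_count:
  assumes "alternating u"
  shows "length (filter acquires u) = length (filter releases u) + length u mod 2"
proof -
  have "acquires e \<Longrightarrow> \<not> releases e" for e by (cases "action e") auto
  then show ?thesis using assms
    by (induction u rule: alternating.induct) auto
qed

lemma proj_filter: "proj q (filter P u) = filter P (proj q u)"
  by (induction u) auto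

lemma set_proj: "set (proj q u) = {e \<in> set u. proc e = q}"
  by (auto simp: proj_def)

lemma distinct_if_proj: "(\<And>q. distinct (proj q u)) \<Longrightarrow> distinct u"
proof (induction u)
  case (Cons x u)
  have "distinct (proj q u)" for q using Cons.prems[of q] by (auto split: if_splits)
  moreover have "x \<notin> set u" using Cons.prems[of "proc x"] by (auto simp: set_proj)
  ultimately show ?case using Cons.IH by simp
qed simp

lemma distinct_proj: "distinct u \<Longrightarrow> distinct (proj q u)"
  by (simp add: proj_def)

lemma obs_append:
  assumes "r \<notin> set u"
  shows "obs (u @ r # v) r = last (filter (\<lambda>w. writes w \<and> loc w = loc r) u)"
  unfolding obs_def using assms by (subst takeWhile_append2) auto

text \<open>\<open>obs\<close> takes \<open>last\<close> of a filtered list; the read condition of a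
  trace is what makes that list non-empty.\<close>

lemma obs_write:
  assumes "is_trace t" "r \<in> set t" "reads r"
  shows "writes (obs t r) \<and> loc (obs t r) = loc r \<and> before t (obs t r) r"
proof -
  obtain u v where t: "t = u @ r # v" using assms(2) by (meson split_list)
  have d: "r \<notin> set u" "distinct t" using assms(1) t by (auto simp: is_trace_def)
  obtain w where w: "writes w" "loc w = loc r" "before t w r"
    using assms unfolding is_trace_def by blast
  have "w \<in> set u" using w(3) d unfolding t
    by (auto simp: before_append before_Cons dest: before_in_set)
  then have "filter (\<lambda>w. writes w \<and> loc w = loc r) u \<noteq> []" using w by (auto simp: filter_empty_conv)
  from last_in_set[OF this] show ?thesis
    unfolding t obs_append[OF d(1)] by (auto simp: before_append)
qed

section \<open>Reorderings as sequences of allowed steps\<close>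

text \<open>\<open>X\<close> is the set of events to be executed in total, \<open>U\<close> the set of those executed so far.\<close>

definition allowed :: "event list \<Rightarrow> event set \<Rightarrow> event set \<Rightarrow> event \<Rightarrow> bool" where
  "allowed t X U e \<longleftrightarrow>
     (reads e \<longrightarrow> obs t e \<in> U) \<and>
     (writes e \<longrightarrow> (\<forall>r \<in> X - U. reads r \<and> loc r = loc e \<longrightarrow> obs t r \<notin> U)) \<and>
     (acquires e \<longrightarrow> card {c \<in> U. acquires c \<and> loc c = loc e} \<le>
                     card {c \<in> U. releases c \<and> loc c = loc e})"

definition legal :: "event list \<Rightarrow> event set \<Rightarrow> event list \<Rightarrow> bool" where
  "legal t X u \<longleftrightarrow> (\<forall>v e w. u = v @ e # w \<longrightarrow> allowed t X (set v) e)"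

lemma legal_Nil: "legal t X []"
  by (simp add: legal_def)

lemma legal_snoc: "legal t X (u @ [e]) \<longleftrightarrow> legal t X u \<and> allowed t X (set u) e"
proof
  assume *: "legal t X (u @ [e])"
  have "allowed t X (set v) e'" if "u = v @ e' # w" for v e' w
    using * that unfolding legal_def by (metis append.assoc append_Cons)
  then show "legal t X u \<and> allowed t X (set u) e"
    using * unfolding legal_def by blast
next
  assume *: "legal t X u \<and> allowed t X (set u) e"
  show "legal t X (u @ [e])"
    unfolding legal_def
  proof (intro allI impI)
    fix v e' w assume "u @ [e] = v @ e' # w"
    then show "allowed t X (set v) e'"
      using * unfolding legal_def by (cases w rule: rev_cases) auto
  qed
qed

section \<open>Legal sequences and correct reorderings\<close>

lemma card_on:
  assumes "distinct u"
  shows "card {c \<in> set u. P c \<and> loc c = l} = length (filter P (on l u))"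
proof -
  have "{c \<in> set u. P c \<and> loc c = l} = set (filter P (on l u))" by auto
  then show ?thesis using distinct_card[of "filter P (on l u)"] assms by simp
qed

lemma acquire_allowed_iff:
  assumes "distinct u" "alternating (on l u)"
  shows "card {c \<in> set u. acquires c \<and> loc c = l} \<le> card {c \<in> set u. releases c \<and> loc c = l}
    \<longleftrightarrow> even (length (on l u))"
  using card_on[OF assms(1), of acquires l] card_on[OF assms(1), of releases l]
    alternating_count[OF assms(2)] by (auto simp: even_iff_mod_2_eq_zero)

text \<open>This justifies that \<open>allowed\<close> has no clause for releases. For an acquire
  the counters show that the lock is free. For a release, the projection of the given trace to its
  process shows an open acquire of that process, and alternation of the part built so far leaves
  room for only one open acquire.\<close>

lemma legal_alternating:
  assumes t: "is_trace t" and "legal t X u" "\<And>q. prefix (proj q u) (proj q t)"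
  shows "alternating (on (Lock l) u)"
  using assms(2,3)
proof (induction u rule: rev_induct)
  case (snoc e u)
  have pre: "prefix (proj q u) (proj q t)" for q
    using snoc.prems(2)[of q] by (auto intro: prefix_order.trans[OF prefixI])
  have IH: "alternating (on (Lock l) u)"
    using snoc.IH snoc.prems(1) pre by (simp add: legal_snoc)
  have "distinct t" using t by (simp add: is_trace_def)
  have dist: "distinct u"
    using distinct_if_proj distinct_proj[OF \<open>distinct t\<close>] pre by (metis prefixE distinct_append)
  show ?case
  proof (cases "loc e = Lock l")
    case True
    let ?u = "on (Lock l) u"
    let ?q = "proc e"
    have "prefix (on (Lock l) (proj ?q (u @ [e]))) (on (Lock l) (proj ?q t))"
      using snoc.prems(2) by (rule filter_mono_prefix)
    moreover have "alternating (on (Lock l) (proj ?q t))"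
      using t alternating_proj[of "on (Lock l) t" ?q] by (simp add: is_trace_iff proj_filter)
    ultimately have "alternating (on (Lock l) (proj ?q (u @ [e])))"
      by (metis alternating_append prefixE)
    then have alt: "alternating (proj ?q ?u @ [e])" using True by (simp add: proj_filter)
    from on_lock_cases[OF True] show ?thesis
    proof
      assume e: "acquires e \<and> \<not> releases e"
      then have "even (length ?u)"
        using snoc.prems(1) True acquire_allowed_iff[OF dist IH]
        by (simp add: legal_snoc allowed_def)
      then show ?thesis using IH e True by (simp add: alternating_snoc)
    next
      assume e: "\<not> acquires e \<and> releases e"
      then have odd: "odd (length (proj ?q ?u))" using alt by (auto simp: alternating_snoc split: if_splits)
      then have odd': "odd (length ?u)" using even_length_proj[OF IH] by blast
      then obtain v c where v: "?u = v @ [c]" by (cases ?u rule: rev_cases) auto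
      then have "even (length v)" "alternating v" using odd' IH by (auto simp: alternating_snoc)
      \<comment> \<open>If the last event \<open>c\<close> on the lock belonged to another process,
        the projection of \<open>?u\<close> would equal that of \<open>v\<close> and have even
        length, contrary to \<open>odd\<close>.\<close>
      then have "even (length (proj ?q v))" by (rule even_length_proj[rotated])
      then have "proc c = ?q" using odd v by (auto split: if_splits)
      then have "alternating (?u @ [e])"
        unfolding alternating_snoc using IH e odd' v by simp
      then show ?thesis using True by simp
    qed
  qed (use IH in simp)
qed simp

text \<open>A read is executed only after the write it must observe. A further write to the variable
  in between would have met the read still pending with its write already done, and
  \<open>allowed\<close> forbids exactly this. So the last write before the read is the right
  one.\<close>

lemma legal_imp_correct_reordering:
  assumes t: "is_trace t" and legal: "legal t (set u) u"
    and pre: "\<And>q. prefix (proj q u) (proj q t)"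
  shows "correct_reordering t u"
proof -
  have "distinct t" using t by (simp add: is_trace_def)
  have dist: "distinct u"
    using distinct_if_proj distinct_proj[OF \<open>distinct t\<close>] pre by (metis prefixE distinct_append)
  have sub: "e \<in> set t" if "e \<in> set u" for e
    using pre[of "proc e"] that set_mono_prefix by (fastforce simp: set_proj)
  have reads: "before u (obs t r) r \<and> obs u r = obs t r" if r: "r \<in> set u" "reads r" for r
  proof -
    let ?w = "obs t r"
    obtain v z where u: "u = v @ r # z" using r(1) by (meson split_list)
    have w: "writes ?w" "loc ?w = loc r" using obs_write[OF t sub[OF r(1)] r(2)] by auto
    have "?w \<in> set v" using legal r(2) u unfolding legal_def allowed_def by blast
    then obtain v1 v2 where v: "v = v1 @ ?w # v2" by (meson split_list)
    have "filter (\<lambda>w. writes w \<and> loc w = loc r) v2 = []"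
    proof (rule ccontr)
      assume "filter (\<lambda>w. writes w \<and> loc w = loc r) v2 \<noteq> []"
      then obtain e where e: "e \<in> set v2" "writes e" "loc e = loc r"
        by (auto simp: filter_empty_conv)
      then obtain y1 y2 where v2: "v2 = y1 @ e # y2" by (meson split_list)
      let ?U = "v1 @ ?w # y1"
      have "u = ?U @ e # (y2 @ r # z)" using u v v2 by simp
      then have "allowed t (set u) (set ?U) e" using legal unfolding legal_def by blast
      moreover have "r \<notin> set ?U" using dist u v v2 by auto
      ultimately show False using e r unfolding allowed_def by auto
    qed
    moreover have "r \<notin> set v" using dist u by auto
    ultimately have "obs u r = ?w" unfolding u obs_append[OF \<open>r \<notin> set v\<close>] using v w by simp
    then show ?thesis using \<open>?w \<in> set v\<close> u by (auto simp: before_append)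
  qed
  have "is_trace u"
    unfolding is_trace_iff
  proof (intro conjI allI ballI impI)
    show "alternating (on (Lock l) u)" for l
      using legal_alternating[OF t legal pre] by blast
    fix r assume r: "r \<in> set u" "reads r"
    show "\<exists>w\<in>set u. writes w \<and> loc w = loc r \<and> before u w r"
      using reads[OF r] obs_write[OF t sub[OF r(1)] r(2)] before_in_set by blast
  qed (rule dist)
  then show ?thesis using pre reads by (auto simp: correct_reordering_def)
qed

text \<open>The converse, with the events of \<open>u\<close> as the set to be executed. A write
  executed between a read and the write observed by it would change the observation, and an acquire
  of a held lock would break alternation.\<close>

lemma correct_reordering_imp_legal:
  assumes cr: "correct_reordering t u"
  shows "legal t (set u) u"
  unfolding legal_def
proof (intro allI impI)
  fix v e w assume u: "u = v @ e # w"
  have tr: "is_trace u" and ob: "\<And>r. r \<in> set u \<Longrightarrow> reads r \<Longrightarrow> obs u r = obs t r"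
    using cr by (auto simp: correct_reordering_def)
  have dist: "distinct u" using tr by (simp add: is_trace_def)
  show "allowed t (set u) (set v) e"
    unfolding allowed_def
  proof (intro conjI impI ballI notI)
    assume "reads e"
    then have "before u (obs t e) e" using obs_write[OF tr, of e] ob[of e] u by auto
    then show "obs t e \<in> set v"
      using dist u by (auto simp: before_append before_Cons dest: before_in_set)
  next
    fix r assume e: "writes e" and r: "r \<in> set u - set v" "reads r \<and> loc r = loc e"
      and w: "obs t r \<in> set v"
    have "r \<noteq> e" using e r by (cases "action e") auto
    then have "r \<in> set w" using r u by auto
    then obtain w1 w2 where w12: "w = w1 @ r # w2" by (meson split_list)
    have "u = (v @ e # w1) @ r # w2" using u w12 by simp
    moreover have "r \<notin> set (v @ e # w1)" using dist u w12 by auto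
    ultimately have "obs u r = last (filter (\<lambda>w. writes w \<and> loc w = loc r) (v @ e # w1))"
      using obs_append by metis
    \<comment> \<open>The write \<open>e\<close> precedes \<open>r\<close>, so the last write before
      \<open>r\<close> is \<open>e\<close> or a later event. It therefore lies outside
      \<open>v\<close>, which contains \<open>obs t r\<close>.\<close>
    also have "\<dots> \<in> set (e # w1)"
    proof -
      have "last (filter (\<lambda>w. writes w \<and> loc w = loc r) (v @ e # w1)) =
        last (e # filter (\<lambda>w. writes w \<and> loc w = loc r) w1)" using e r by simp
      also have "\<dots> \<in> set (e # filter (\<lambda>w. writes w \<and> loc w = loc r) w1)"
        by (rule last_in_set) simp
      finally show ?thesis by auto
    qed
    finally show False using ob[of r] r w dist u w12 by auto
  next
    assume a: "acquires e"
    then obtain l where l: "loc e = Lock l" by (cases "action e") auto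
    have "on (Lock l) u = on (Lock l) (v @ [e]) @ on (Lock l) w" using u by simp
    then have "alternating (on (Lock l) (v @ [e]))"
      using tr alternating_append unfolding is_trace_iff by metis
    then have *: "alternating (on (Lock l) v @ [e])" using l by simp
    have "distinct v" using dist u by simp
    have "even (length (on (Lock l) v))"
      using * on_lock_cases[OF l] a by (auto simp: alternating_snoc split: if_splits)
    then show "card {c \<in> set v. acquires c \<and> loc c = loc e} \<le>
       card {c \<in> set v. releases c \<and> loc c = loc e}"
      using acquire_allowed_iff[OF \<open>distinct v\<close> alternating_append[OF *]] l by simp
  qed
qed

text \<open>One of the two events is a write. Placed first, it provides the earlier write that the
  other event needs if it is a read; which write is observed there does not matter. Neither event
  touches a lock.\<close>

lemma is_trace_append_conflicting:
  assumes tr: "is_trace u" and c: "conflicting e1 e2" and d: "e1 \<notin> set u" "e2 \<notin> set u"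
  shows "is_trace (u @ [e1, e2]) \<or> is_trace (u @ [e2, e1])"
proof -
  have one: "is_trace (u @ [a, b])"
    if c: "conflicting a b" and a: "writes a" and d: "a \<notin> set u" "b \<notin> set u" for a b
  proof -
    have ab: "a \<noteq> b" "writes b \<or> reads b" "loc a = loc b" using c by (auto simp: conflicting_def)
    have nl: "loc a \<noteq> Lock l" "loc b \<noteq> Lock l" "\<not> reads a" for l
      using a ab by (cases "action a"; auto)+
    show ?thesis
      unfolding is_trace_iff
    proof (intro conjI allI ballI impI)
      show "distinct (u @ [a, b])" using tr d ab by (simp add: is_trace_def)
      show "alternating (on (Lock l) (u @ [a, b]))" for l using tr nl by (simp add: is_trace_iff)
      fix r assume r: "r \<in> set (u @ [a, b])" "reads r"
      then consider "r \<in> set u" | "r = b" using nl by auto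
      then show "\<exists>w\<in>set (u @ [a, b]). writes w \<and> loc w = loc r \<and> before (u @ [a, b]) w r"
      proof cases
        case 1
        then show ?thesis using tr r unfolding is_trace_def before_append by fastforce
      next
        case 2
        then show ?thesis using a ab by (intro bexI[of _ a]) (auto simp: before_append before_Cons)
      qed
    qed
  qed
  have "conflicting e2 e1" "writes e1 \<or> writes e2" using c by (auto simp: conflicting_def)
  then show ?thesis using one[of e1 e2] one[of e2 e1] c d by blast
qed

text \<open>
  The pair \<open>(i, j)\<close> stands for the set of the events of process 0 at positions of \<open>t\<close> below \<open>i\<close> and
  those of process 1 at positions below \<open>j\<close>. As these are positions in \<open>t\<close>, a step that advances
  past an event of the other process executes nothing and is always enabled.
\<close>

definition inS :: "event list \<Rightarrow> nat \<Rightarrow> nat \<Rightarrow> nat \<Rightarrow> bool" where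
  "inS t i j r \<longleftrightarrow> r < (if proc (t ! r) = 0 then i else j)"

definition done_at :: "event list \<Rightarrow> nat \<Rightarrow> nat \<Rightarrow> event set" where
  "done_at t i j = (!) t ` {r. r < length t \<and> inS t i j r}"

definition enabled :: "event list \<Rightarrow> nat \<Rightarrow> nat \<Rightarrow> nat \<Rightarrow> nat \<Rightarrow> nat \<Rightarrow> bool" where
  "enabled t a b q i j \<longleftrightarrow>
     (let e = t ! (if q = 0 then i else j)
      in proc e = q \<longrightarrow> allowed t (done_at t a b) (done_at t i j) e)"

inductive reach :: "event list \<Rightarrow> nat \<Rightarrow> nat \<Rightarrow> nat \<Rightarrow> nat \<Rightarrow> bool" for t a b where
  start: "reach t a b 0 0"
| left: "reach t a b i j \<Longrightarrow> i < length t \<Longrightarrow> enabled t a b 0 i j \<Longrightarrow> reach t a b (Suc i) j"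
| right: "reach t a b i j \<Longrightarrow> j < length t \<Longrightarrow> enabled t a b 1 i j \<Longrightarrow> reach t a b i (Suc j)"

text \<open>The bound on the processes makes the two projections determine the set of events of
  \<open>u\<close>.\<close>

definition schedule :: "event list \<Rightarrow> nat \<Rightarrow> nat \<Rightarrow> event list \<Rightarrow> bool" where
  "schedule t i j u \<longleftrightarrow> proj 0 u = proj 0 (take i t) \<and> proj 1 u = proj 1 (take j t) \<and>
     (\<forall>e \<in> set u. proc e < 2)"

section \<open>Schedules and reachable pairs of prefixes\<close>

lemma set_take_conv: "set (take i t) = (!) t ` {r. r < length t \<and> r < i}"
  by (fastforce simp: in_set_conv_nth image_iff)

text \<open>All interleavings that lead to a pair execute the same set, and \<open>allowed\<close>
  depends on that set only. This is why reachability may forget the sequence.\<close>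

lemma schedule_set:
  assumes "schedule t i j u" "\<And>e. e \<in> set t \<Longrightarrow> proc e < 2"
  shows "set u = done_at t i j"
proof -
  have "set u = set (proj 0 u) \<union> set (proj 1 u)"
  proof -
    have "proc e = 0 \<or> proc e = 1" if "e \<in> set u" for e
      using assms(1) that by (auto simp: schedule_def less_2_cases_iff)
    then show ?thesis by (auto simp: set_proj)
  qed
  also have "\<dots> = {e \<in> set (take i t). proc e = 0} \<union> {e \<in> set (take j t). proc e = 1}"
    using assms(1) unfolding schedule_def by (simp add: set_proj)
  also have "\<dots> = done_at t i j"
  proof -
    have p: "proc (t ! r) = Suc 0" if "r < length t" "proc (t ! r) \<noteq> 0" for r
      using assms(2)[of "t ! r"] that by auto
    show ?thesis
      unfolding done_at_def set_take_conv inS_def by (auto split: if_splits dest: p)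
  qed
  finally show ?thesis .
qed

lemma schedule_prefix:
  assumes "schedule t i j u"
  shows "prefix (proj q u) (proj q t)"
proof -
  have take: "prefix (proj q (take i t)) (proj q t)" for i
    by (metis append_take_drop_id prefixI proj_simps(3))
  consider "q = 0" | "q = 1" | "q \<ge> 2" by linarith
  then show ?thesis
  proof cases
    case 3
    then have "set (proj q u) = {}" using assms unfolding schedule_def set_proj by fastforce
    then show ?thesis by simp
  qed (use assms take in \<open>auto simp: schedule_def\<close>)
qed

lemma proj_take_Suc:
  "i < length t \<Longrightarrow>
   proj q (take (Suc i) t) = proj q (take i t) @ (if proc (t ! i) = q then [t ! i] else [])"
  by (simp add: take_Suc_conv_app_nth)

lemma reach_imp_schedule:
  assumes "reach t a b i j" "\<And>e. e \<in> set t \<Longrightarrow> proc e < 2"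
  shows "\<exists>u. schedule t i j u \<and> legal t (done_at t a b) u"
  using assms(1)
proof induction
  case start
  show ?case by (intro exI[of _ "[]"]) (simp add: schedule_def legal_Nil)
next
  case (left i j)
  then obtain u where u: "schedule t i j u" "legal t (done_at t a b) u" by blast
  show ?case
  proof (cases "proc (t ! i) = 0")
    case True
    then have "legal t (done_at t a b) (u @ [t ! i])"
      using u left(3) schedule_set[OF u(1) assms(2)] by (simp add: legal_snoc enabled_def)
    moreover have "schedule t (Suc i) j (u @ [t ! i])"
      using u(1) True left(2) by (simp add: schedule_def proj_take_Suc)
    ultimately show ?thesis by blast
  next
    case False
    then show ?thesis using u left(2) by (auto simp: schedule_def proj_take_Suc)
  qed
next
  case (right i j)
  then obtain u where u: "schedule t i j u" "legal t (done_at t a b) u" by blast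
  show ?case
  proof (cases "proc (t ! j) = 1")
    case True
    then have "legal t (done_at t a b) (u @ [t ! j])"
      using u right(3) schedule_set[OF u(1) assms(2)] by (simp add: legal_snoc enabled_def)
    moreover have "schedule t i (Suc j) (u @ [t ! j])"
      using u(1) True right(2) by (simp add: schedule_def proj_take_Suc)
    ultimately show ?thesis by blast
  next
    case False
    then show ?thesis using u right(2) by (auto simp: schedule_def proj_take_Suc)
  qed
qed

text \<open>The induction is on \<open>i + j\<close> and not on the list, since a step past a
  foreign event changes the pair but not the list. Once such positions are stripped, the last event
  of \<open>u\<close> is the event just before \<open>i\<close> or just before \<open>j\<close> in
  \<open>t\<close>, according to its process.\<close>

lemma schedule_imp_reach:
  assumes "schedule t i j u" "legal t (done_at t a b) u" "\<And>e. e \<in> set t \<Longrightarrow> proc e < 2"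
    "i \<le> length t" "j \<le> length t"
  shows "reach t a b i j"
  using assms(1,2,4,5)
proof (induction "i + j" arbitrary: i j u rule: less_induct)
  case less
  consider (skip0) i' where "i = Suc i'" "proc (t ! i') \<noteq> 0"
    | (skip1) j' where "j = Suc j'" "proc (t ! j') \<noteq> 1"
    | (ex) "\<And>i'. i = Suc i' \<Longrightarrow> proc (t ! i') = 0" "\<And>j'. j = Suc j' \<Longrightarrow> proc (t ! j') = 1"
    by blast
  then show ?case
  proof cases
    case skip0
    then have "schedule t i' j u" using less.prems by (simp add: schedule_def proj_take_Suc)
    then have "reach t a b i' j" using less skip0 by auto
    then show ?thesis
      unfolding skip0(1) by (rule reach.left) (use skip0 less.prems in \<open>auto simp: enabled_def\<close>)
  next
    case skip1
    then have "schedule t i j' u" using less.prems by (simp add: schedule_def proj_take_Suc)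
    then have "reach t a b i j'" using less skip1 by auto
    then show ?thesis
      unfolding skip1(1) by (rule reach.right) (use skip1 less.prems in \<open>auto simp: enabled_def\<close>)
  next
    case ex
    show ?thesis
    proof (cases u rule: rev_cases)
      case Nil
      have "i = 0"
      proof (rule ccontr)
        assume "i \<noteq> 0"
        then obtain i' where "i = Suc i'" by (cases i) auto
        then show False using ex(1)[of i'] less.prems Nil by (simp add: schedule_def proj_take_Suc)
      qed
      moreover have "j = 0"
      proof (rule ccontr)
        assume "j \<noteq> 0"
        then obtain j' where "j = Suc j'" by (cases j) auto
        then show False using ex(2)[of j'] less.prems Nil by (simp add: schedule_def proj_take_Suc)
      qed
      ultimately show ?thesis by (simp add: reach.start)
    next
      case (snoc v e)
      have leg: "legal t (done_at t a b) v" "allowed t (done_at t a b) (set v) e"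
        using less.prems(2) unfolding snoc legal_snoc by auto
      have "proc e < 2" using less.prems(1) snoc by (simp add: schedule_def)
      then consider "proc e = 0" | "proc e = 1" by linarith
      then show ?thesis
      proof cases
        case 1
        then have p: "proj 0 v @ [e] = proj 0 (take i t)"
          using less.prems(1) snoc by (simp add: schedule_def)
        then obtain i' where i: "i = Suc i'" by (cases i) auto
        then have e: "e = t ! i'" "proj 0 v = proj 0 (take i' t)"
          using p ex(1)[OF i] less.prems(3) by (auto simp: proj_take_Suc)
        then have v: "schedule t i' j v"
          using less.prems(1) snoc 1 by (simp add: schedule_def)
        then have "reach t a b i' j" using less leg i by auto
        then show ?thesis
          unfolding i
          by (rule reach.left)
             (use leg e i less.prems schedule_set[OF v assms(3)] in \<open>auto simp: enabled_def\<close>)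
      next
        case 2
        then have p: "proj 1 v @ [e] = proj 1 (take j t)"
          using less.prems(1) snoc by (simp add: schedule_def)
        then obtain j' where j: "j = Suc j'" by (cases j) auto
        then have e: "e = t ! j'" "proj 1 v = proj 1 (take j' t)"
          using p ex(2)[OF j] less.prems(4) by (auto simp: proj_take_Suc)
        then have v: "schedule t i j' v"
          using less.prems(1) snoc 2 by (simp add: schedule_def)
        then have "reach t a b i j'" using less leg j by auto
        then show ?thesis
          unfolding j
          by (rule reach.right)
             (use leg e j less.prems schedule_set[OF v assms(3)] in \<open>auto simp: enabled_def\<close>)
      qed
    qed
  qed
qed

text \<open>Being the next event of its process fixes everything that the process has executed,
  because events are distinct. With two processes a target therefore leaves no choice of the set to
  be executed.\<close>

lemma prefix_proj_nth:
  assumes "distinct t" "a < length t"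
  shows "prefix (v @ [t ! a]) (proj (proc (t ! a)) t) \<longleftrightarrow> v = proj (proc (t ! a)) (take a t)"
proof -
  let ?q = "proc (t ! a)"
  have "t = take a t @ t ! a # drop (Suc a) t" using assms(2) by (simp add: id_take_nth_drop)
  then have t: "proj ?q t = proj ?q (take a t) @ t ! a # proj ?q (drop (Suc a) t)"
    by (metis proj_simps(2,3))
  have d: "distinct (proj ?q t)" using assms(1) by (rule distinct_proj)
  show ?thesis
  proof
    assume "prefix (v @ [t ! a]) (proj ?q t)"
    then obtain z where z: "proj ?q t = v @ t ! a # z" by (auto simp: prefix_def)
    have "v = proj ?q (take a t) \<and> z = proj ?q (drop (Suc a) t)"
      by (rule iffD1[OF append_Cons_eq_iff]) (use z t d in \<open>auto simp: \<close>)
    then show "v = proj ?q (take a t)" ..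
  qed (subst t, simp)
qed

text \<open>The pair \<open>(a, b)\<close> occurs twice in \<open>reach t a b a b\<close>: as the
  target, which determines the reads that are still to come, and as the endpoint of the
  path.\<close>

lemma predictable_race_iff_reach:
  assumes t: "is_trace t" and p: "\<And>e. e \<in> set t \<Longrightarrow> proc e < 2"
    and ab: "a < length t" "b < length t" "proc (t ! a) = 0" "proc (t ! b) = 1"
  shows "predictable_race t (t ! a) (t ! b) \<longleftrightarrow>
    conflicting (t ! a) (t ! b) \<and> reach t a b a b"
proof
  have d: "distinct t" using t by (simp add: is_trace_def)
  note pre = prefix_proj_nth[OF d ab(1)] prefix_proj_nth[OF d ab(2)]
  {
    assume "predictable_race t (t ! a) (t ! b)"
    then obtain u where c: "conflicting (t ! a) (t ! b)" and u: "correct_reordering t u"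
      "prefix (proj 0 u @ [t ! a]) (proj 0 t)" "prefix (proj 1 u @ [t ! b]) (proj 1 t)"
      using ab unfolding predictable_race_def by auto
    have "proc e < 2" if "e \<in> set u" for e
    proof -
      have "prefix (proj (proc e) u) (proj (proc e) t)" using u by (simp add: correct_reordering_def)
      then have "e \<in> set t" using that set_mono_prefix by (fastforce simp: set_proj)
      then show ?thesis by (rule p)
    qed
    then have s: "schedule t a b u" using u(2,3) pre ab by (simp add: schedule_def)
    have "legal t (done_at t a b) u"
      using correct_reordering_imp_legal[OF u(1)] schedule_set[OF s p] by simp
    then have "reach t a b a b" using schedule_imp_reach[OF s _ p] ab by simp
    with c show "conflicting (t ! a) (t ! b) \<and> reach t a b a b" ..
  }
  {
    assume *: "conflicting (t ! a) (t ! b) \<and> reach t a b a b"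
    then obtain u where s: "schedule t a b u" and l: "legal t (done_at t a b) u"
      using reach_imp_schedule p by blast
    have cr: "correct_reordering t u"
      using legal_imp_correct_reordering[OF t _ schedule_prefix[OF s]] l schedule_set[OF s p] by simp
    have "set u = done_at t a b" by (rule schedule_set[OF s p])
    then have "t ! a \<notin> set u" "t ! b \<notin> set u"
      using ab d by (auto simp: done_at_def inS_def nth_eq_iff_index_eq)
    then have "is_trace (u @ [t ! a, t ! b]) \<or> is_trace (u @ [t ! b, t ! a])"
      using is_trace_append_conflicting * cr by (simp add: correct_reordering_def)
    moreover have "prefix (proj 0 u @ [t ! a]) (proj 0 t)" "prefix (proj 1 u @ [t ! b]) (proj 1 t)"
      using pre ab s by (auto simp: schedule_def)
    ultimately show "predictable_race t (t ! a) (t ! b)"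
      using * cr ab unfolding predictable_race_def by auto
  }
qed

lemma predictable_race_sym: "predictable_race t e1 e2 \<longleftrightarrow> predictable_race t e2 e1"
  unfolding predictable_race_def conflicting_def by auto

section \<open>Program logic\<close>

text \<open>Weakest preconditions of loop-free programs. A load has no side condition, since all values
  in memory stay below the word bound once they are so in the initial state.\<close>

fun wp :: "nat \<Rightarrow> com \<Rightarrow> (state \<Rightarrow> bool) \<Rightarrow> state \<Rightarrow> bool" where
  "wp W Skip Q s \<longleftrightarrow> Q s"
| "wp W (Const r v) Q s \<longleftrightarrow> v < W \<and> Q (s\<lparr>reg := (reg s)(r := v)\<rparr>)"
| "wp W (Arith f r a b) Q s \<longleftrightarrow> binop_val f (reg s a) (reg s b) < W \<and>
     Q (s\<lparr>reg := (reg s)(r := binop_val f (reg s a) (reg s b))\<rparr>)"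
| "wp W (Load r a) Q s \<longleftrightarrow> Q (s\<lparr>reg := (reg s)(r := mem s (reg s a))\<rparr>)"
| "wp W (Store a b) Q s \<longleftrightarrow> Q (s\<lparr>mem := (mem s)(reg s a := reg s b)\<rparr>)"
| "wp W (Report a b) Q s \<longleftrightarrow> Q (s\<lparr>out := out s @ [(reg s a, reg s b)]\<rparr>)"
| "wp W (Seq c1 c2) Q s \<longleftrightarrow> wp W c1 (wp W c2 Q) s"
| "wp W (IfLess a b c1 c2) Q s \<longleftrightarrow> (if reg s a < reg s b then wp W c1 Q s else wp W c2 Q s)"
| "wp W (WhileLess a b c) Q s \<longleftrightarrow> False"

text \<open>Both branches of a test are charged. This overestimates the time, but keeps the cost
  independent of the state.\<close>

fun cost :: "com \<Rightarrow> nat" where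
  "cost (Seq c1 c2) = cost c1 + cost c2"
| "cost (IfLess a b c1 c2) = Suc (cost c1 + cost c2)"
| "cost c = 1"

definition bounded :: "nat \<Rightarrow> state \<Rightarrow> bool" where
  "bounded W s \<longleftrightarrow> (\<forall>r. reg s r < W) \<and> (\<forall>x. mem s x < W)"

text \<open>\<open>bounded\<close> is assumed at the start and guaranteed at the end of every
  triple, which is what allows \<open>wp\<close> to omit the side condition of \<open>Load\<close>.
  A \<open>Store\<close> preserves it because registers are bounded too.\<close>

definition run :: "nat \<Rightarrow> nat \<Rightarrow> com \<Rightarrow> (state \<Rightarrow> bool) \<Rightarrow> state \<Rightarrow> bool" where
  "run W b c Q s \<longleftrightarrow> (bounded W s \<longrightarrow>
     (\<exists>\<tau> s'. exec W c s \<tau> s' \<and> \<tau> \<le> b \<and> bounded W s' \<and> Q s'))"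

lemma wp_mono: "wp W c Q s \<Longrightarrow> (\<And>s. Q s \<Longrightarrow> Q' s) \<Longrightarrow> wp W c Q' s"
proof (induction c arbitrary: s Q Q')
  case (Seq c1 c2)
  from Seq.prems(1) have "wp W c1 (wp W c2 Q) s" by simp
  then have "wp W c1 (wp W c2 Q') s"
    by (rule Seq.IH(1)) (rule Seq.IH(2)[OF _ Seq.prems(2)])
  then show ?case by simp
next
  case (IfLess a b c1 c2)
  then show ?case using IfLess.IH[of Q s Q'] by (auto split: if_splits)
qed simp_all

lemma run_Seq:
  assumes "run W b1 c1 (run W b2 c2 Q) s"
  shows "run W (b1 + b2) (Seq c1 c2) Q s"
  unfolding run_def
proof
  assume "bounded W s"
  then obtain \<tau>1 s1 where 1: "exec W c1 s \<tau>1 s1" "\<tau>1 \<le> b1" "bounded W s1" "run W b2 c2 Q s1"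
    using assms unfolding run_def by blast
  then obtain \<tau>2 s2 where 2: "exec W c2 s1 \<tau>2 s2" "\<tau>2 \<le> b2" "bounded W s2" "Q s2"
    unfolding run_def by blast
  have "exec W (Seq c1 c2) s (\<tau>1 + \<tau>2) s2" using 1(1) 2(1) by (rule exec.Seq)
  then show "\<exists>\<tau> s'. exec W (Seq c1 c2) s \<tau> s' \<and> \<tau> \<le> b1 + b2 \<and> bounded W s' \<and> Q s'"
    using 1(2) 2 add_mono by blast
qed

lemma run_If:
  assumes "reg s x < reg s y \<Longrightarrow> run W b1 c1 Q s" "\<not> reg s x < reg s y \<Longrightarrow> run W b2 c2 Q s"
  shows "run W (Suc (b1 + b2)) (IfLess x y c1 c2) Q s"
  unfolding run_def
proof
  assume bd: "bounded W s"
  show "\<exists>\<tau> s'. exec W (IfLess x y c1 c2) s \<tau> s' \<and> \<tau> \<le> Suc (b1 + b2) \<and> bounded W s' \<and> Q s'"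
  proof (cases "reg s x < reg s y")
    case True
    then obtain \<tau> s' where 1: "exec W c1 s \<tau> s'" "\<tau> \<le> b1" "bounded W s'" "Q s'"
      using assms(1) bd unfolding run_def by blast
    have "exec W (IfLess x y c1 c2) s (Suc \<tau>) s'" using True 1(1) by (rule exec.IfTrue)
    moreover have "Suc \<tau> \<le> Suc (b1 + b2)" using 1(2) by simp
    ultimately show ?thesis using 1(3,4) by blast
  next
    case False
    then obtain \<tau> s' where 1: "exec W c2 s \<tau> s'" "\<tau> \<le> b2" "bounded W s'" "Q s'"
      using assms(2) bd unfolding run_def by blast
    have "exec W (IfLess x y c1 c2) s (Suc \<tau>) s'" using False 1(1) by (rule exec.IfFalse)
    moreover have "Suc \<tau> \<le> Suc (b1 + b2)" using 1(2) by simp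
    ultimately show ?thesis using 1(3,4) by blast
  qed
qed

lemma run_mono:
  assumes "run W b c Q s" "b \<le> b'" "\<And>s. Q s \<Longrightarrow> Q' s"
  shows "run W b' c Q' s"
  unfolding run_def
proof
  assume "bounded W s"
  then obtain \<tau> s' where "exec W c s \<tau> s'" "\<tau> \<le> b" "bounded W s'" "Q s'"
    using assms(1) unfolding run_def by blast
  then show "\<exists>\<tau> s'. exec W c s \<tau> s' \<and> \<tau> \<le> b' \<and> bounded W s' \<and> Q' s'"
    using assms(2,3) le_trans by blast
qed

lemma run_step:
  assumes "bounded W s \<Longrightarrow> exec W c s 1 s'" "bounded W s \<Longrightarrow> bounded W s'" "Q s'"
  shows "run W 1 c Q s"
  using assms unfolding run_def by blast

lemma run_wp: "wp W c Q s \<Longrightarrow> run W (cost c) c Q s"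
proof (induction c arbitrary: s Q)
  case Skip
  show ?case unfolding cost.simps
    by (rule run_step, rule exec.Skip) (use Skip in simp_all)
next
  case (Const r v)
  show ?case unfolding cost.simps
    by (rule run_step, rule exec.Const) (use Const in \<open>simp_all add: bounded_def\<close>)
next
  case (Arith f r a b)
  show ?case unfolding cost.simps
    by (rule run_step, rule exec.Arith, rule refl) (use Arith in \<open>simp_all add: bounded_def\<close>)
next
  case (Load r a)
  show ?case unfolding cost.simps
    by (rule run_step, rule exec.Load, rule refl) (use Load in \<open>simp_all add: bounded_def\<close>)
next
  case (Store a b)
  show ?case unfolding cost.simps
    by (rule run_step, rule exec.Store) (use Store in \<open>simp_all add: bounded_def\<close>)
next
  case (Report a b)
  show ?case unfolding cost.simps
    by (rule run_step, rule exec.Report) (use Report in \<open>simp_all add: bounded_def\<close>)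
next
  case (Seq c1 c2)
  from Seq.prems have "wp W c1 (wp W c2 Q) s" by simp
  then have "wp W c1 (run W (cost c2) c2 Q) s" by (rule wp_mono) (rule Seq.IH(2))
  then show ?case unfolding cost.simps by (intro run_Seq Seq.IH(1))
next
  case (IfLess a b c1 c2)
  show ?case unfolding cost.simps
    by (rule run_If) (use IfLess in \<open>simp_all\<close>)
qed simp

text \<open>All loops of the program count a register up to a fixed bound, so the counter serves as
  the index of the invariant and \<open>n - k\<close> rounds remain. The final failing test is
  charged as a full round, hence the \<open>Suc\<close>.\<close>

lemma run_while:
  assumes I: "I k s" "k \<le> n"
    and regs: "\<And>k s. I k s \<Longrightarrow> reg s x = k \<and> reg s y = n"
    and body: "\<And>k s. k < n \<Longrightarrow> I k s \<Longrightarrow> run W b c (I (Suc k)) s"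
  shows "run W (Suc (n - k) * Suc b) (WhileLess x y c) (I n) s"
  using I
proof (induction "n - k" arbitrary: k s)
  case 0
  then have "k = n" by simp
  then show ?case
    using 0 regs[of k s] exec.WhileFalse[of s x y W c] unfolding run_def by (intro impI exI[of _ 1] exI[of _ s]) auto
next
  case (Suc d)
  then have k: "k < n" "d = n - Suc k" by auto
  show ?case
    unfolding run_def
  proof
    assume bd: "bounded W s"
    obtain \<tau> s1 where s1: "exec W c s \<tau> s1" "\<tau> \<le> b" "bounded W s1" "I (Suc k) s1"
      using body[OF k(1) Suc.prems(1)] bd unfolding run_def by blast
    obtain \<tau>' s2 where s2: "exec W (WhileLess x y c) s1 \<tau>' s2" "\<tau>' \<le> Suc (n - Suc k) * Suc b"
      "bounded W s2" "I n s2"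
      using Suc.hyps(1)[OF k(2) s1(4)] k s1(3) unfolding run_def by auto
    have "exec W (WhileLess x y c) s (Suc (\<tau> + \<tau>')) s2"
      using regs[OF Suc.prems(1)] k s1 s2 by (intro exec.WhileTrue) auto
    moreover have "Suc (\<tau> + \<tau>') \<le> Suc (n - k) * Suc b"
    proof -
      have "n - k = Suc (n - Suc k)" using k(1) by simp
      then show ?thesis using s1(2) s2(2) by simp
    qed
    ultimately show "\<exists>\<tau> s'. exec W (WhileLess x y c) s \<tau> s' \<and> \<tau> \<le> Suc (n - k) * Suc b \<and>
      bounded W s' \<and> I n s'" using s2 by blast
  qed
qed

primrec seq :: "com list \<Rightarrow> com" where
  "seq [] = Skip"
| "seq (c # cs) = Seq c (seq cs)"

section \<open>The program\<close>

text \<open>Registers up to 10 hold constants once \<open>init_regs\<close> has run, and work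
  registers start at 11; this is the bound in \<open>const_regs_upd\<close>. Register 0 is never
  assigned and keeps its initial value 0.\<close>

abbreviation (input) "R_zero \<equiv> 0 :: nat"
abbreviation (input) "R_one \<equiv> 2 :: nat"
abbreviation (input) "R_two \<equiv> 3 :: nat"
abbreviation (input) "R_three \<equiv> 4 :: nat"
abbreviation (input) "R_four \<equiv> 5 :: nat"
abbreviation (input) "R_n \<equiv> 6 :: nat"
abbreviation (input) "R_base \<equiv> 7 :: nat"
abbreviation (input) "R_nn \<equiv> 8 :: nat"
abbreviation (input) "R_nn2 \<equiv> 9 :: nat"
abbreviation (input) "R_rbase \<equiv> 10 :: nat"
abbreviation (input) "R_m \<equiv> 11 :: nat"
abbreviation (input) "R_q \<equiv> 12 :: nat"
abbreviation (input) "R_x \<equiv> 13 :: nat"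
abbreviation (input) "R_i \<equiv> 14 :: nat"
abbreviation (input) "R_j \<equiv> 15 :: nat"
abbreviation (input) "R_p \<equiv> 16 :: nat"
abbreviation (input) "R_pp \<equiv> 17 :: nat"
abbreviation (input) "R_pt \<equiv> 18 :: nat"
abbreviation (input) "R_pv \<equiv> 19 :: nat"
abbreviation (input) "R_f \<equiv> 20 :: nat"
abbreviation (input) "R_g \<equiv> 21 :: nat"
abbreviation (input) "R_A \<equiv> 22 :: nat"
abbreviation (input) "R_B \<equiv> 23 :: nat"
abbreviation (input) "R_acq \<equiv> 24 :: nat"
abbreviation (input) "R_rel \<equiv> 25 :: nat"
abbreviation (input) "R_r \<equiv> 26 :: nat"
abbreviation (input) "R_rp \<equiv> 27 :: nat"
abbreviation (input) "R_rt \<equiv> 28 :: nat"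
abbreviation (input) "R_rv \<equiv> 29 :: nat"
abbreviation (input) "R_s \<equiv> 30 :: nat"
abbreviation (input) "R_target \<equiv> 31 :: nat"
abbreviation (input) "R_a \<equiv> 32 :: nat"
abbreviation (input) "R_b \<equiv> 33 :: nat"
abbreviation (input) "R_c \<equiv> 34 :: nat"

abbreviation "incr r \<equiv> Arith Plus r r R_one"
abbreviation "move r r' \<equiv> Arith Plus r r' R_zero"

definition if_eq :: "nat \<Rightarrow> nat \<Rightarrow> com \<Rightarrow> com \<Rightarrow> com" where
  "if_eq a b c d = IfLess a b d (IfLess b a d c)"

text \<open>The encoded input has four header cells followed by three cells for each event, hence
  the constants 4 and 3.\<close>

definition fetch :: "nat \<Rightarrow> nat \<Rightarrow> nat \<Rightarrow> nat \<Rightarrow> com" where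
  "fetch p rp rt rv = seq [Arith Times R_x R_three p, Arith Plus R_x R_x R_four, Load rp R_x,
     incr R_x, Load rt R_x, incr R_x, Load rv R_x]"

text \<open>Cell 3 holds the length of the trace. Behind the \<open>4 + 3 n\<close> input cells come
  the table, two thresholds for each of \<open>2 n^2\<close> steps, and then one reachability flag
  for each of the \<open>n^2\<close> pairs.\<close>

definition init_regs :: com where
  "init_regs = seq [Const R_one 1, Const R_two 2, Const R_three 3, Const R_four 4, Load R_n R_three,
     Arith Times R_base R_three R_n, Arith Plus R_base R_base R_four,
     Arith Times R_nn R_n R_n, Arith Plus R_nn2 R_nn R_nn,
     Arith Plus R_rbase R_nn2 R_nn2, Arith Plus R_rbase R_base R_rbase]"

definition scan_position :: com where
  "scan_position = seq [fetch R_r R_rp R_rt R_rv, Const R_s 0,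
     IfLess R_rp R_one (IfLess R_r R_i (Const R_s 1) Skip) (IfLess R_r R_j (Const R_s 1) Skip)]"

text \<open>One pass gathers what any type of event at \<open>p\<close> may ask for.
  \<open>R_f\<close> says whether the last write passed so far is executed, \<open>R_g\<close> is
  its value at \<open>p\<close>, and a pending read with \<open>R_f\<close> set lowers the threshold
  of its process to \<open>r + 1\<close>, since thresholds are exclusive and a component at most
  \<open>r\<close> leaves that read out. Only numbers are compared, so a variable and a lock of the
  same number are both processed; this is harmless, as they update different registers.\<close>

definition scan_update :: com where
  "scan_update = seq [
     if_eq R_rv R_pv
       (IfLess R_rt R_one (move R_f R_s)
         (IfLess R_rt R_two
           (seq [if_eq R_r R_p (move R_g R_f) Skip,
              IfLess R_s R_one (IfLess R_zero R_f
                (seq [Arith Plus R_x R_r R_one,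
                   IfLess R_rp R_one (IfLess R_x R_A (move R_A R_x) Skip)
                     (IfLess R_x R_B (move R_B R_x) Skip)]) Skip) Skip])
           (IfLess R_rt R_three (Arith Plus R_acq R_acq R_s) (Arith Plus R_rel R_rel R_s))))
       Skip,
     incr R_r]"

definition scan :: com where
  "scan = WhileLess R_r R_n (Seq scan_position scan_update)"

definition step_init :: com where
  "step_init = seq [Arith Mod R_q R_m R_two, Arith Div R_x R_m R_two,
     Arith Div R_i R_x R_n, Arith Mod R_j R_x R_n,
     IfLess R_q R_one (move R_p R_i) (move R_p R_j), fetch R_p R_pp R_pt R_pv,
     Const R_f 0, Const R_g 0, move R_A R_n, move R_B R_n, Const R_acq 0, Const R_rel 0, Const R_r 0]"

text \<open>Thresholds \<open>n\<close> admit every target with components below \<open>n\<close>;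
  the thresholds 0 of \<open>blocked\<close> admit none.\<close>

definition free :: com where
  "free = seq [move R_A R_n, move R_B R_n]"

definition blocked :: com where
  "blocked = seq [Const R_A 0, Const R_B 0]"

definition step_decide :: com where
  "step_decide = if_eq R_pp R_q
     (IfLess R_pt R_one Skip
       (IfLess R_pt R_two (IfLess R_zero R_g free blocked)
         (IfLess R_pt R_three (IfLess R_rel R_acq blocked free) free)))
     free"

definition step_store :: com where
  "step_store = seq [Arith Plus R_x R_m R_m, Arith Plus R_x R_base R_x, Store R_x R_A,
     incr R_x, Store R_x R_B, incr R_m]"

text \<open>Step number \<open>m = 2 (i n + j) + q\<close> advances process \<open>q\<close> from the pair \<open>(i, j)\<close>. Its thresholds
  are stored at \<open>base + 2 m\<close> and \<open>base + 2 m + 1\<close>; it may be used for the target \<open>(a, b)\<close>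
  iff \<open>a\<close> and \<open>b\<close> are strictly below them.\<close>

definition tabulate :: com where
  "tabulate = Seq (Const R_m 0)
     (WhileLess R_m R_nn2 (Seq step_init (Seq scan (Seq step_decide step_store))))"

text \<open>The entry of a step from pair \<open>x\<close> is at \<open>base + 4 x + 2 q\<close>, so
  the argument either adds 2 or does nothing. \<open>R_c\<close> is only ever raised to 1, so that
  successive calls accumulate a disjunction.\<close>

definition follow :: "com \<Rightarrow> com" where
  "follow shift = seq [Arith Plus R_f R_rbase R_x, Load R_f R_f,
     IfLess R_zero R_f
       (seq [Arith Times R_x R_four R_x, Arith Plus R_x R_base R_x, shift, Load R_A R_x,
          incr R_x, Load R_B R_x,
          IfLess R_a R_A (IfLess R_b R_B (Const R_c 1) Skip) Skip]) Skip]"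

text \<open>Pairs are numbered by rows, \<open>m = i n + j\<close>. The predecessors
  \<open>m - n\<close> and \<open>m - 1\<close> are smaller, so their flags are already there; the
  tests of \<open>i\<close> and \<open>j\<close> prevent leaving the grid or slipping into the
  previous row.\<close>

definition reach_step :: com where
  "reach_step = seq [Arith Div R_i R_m R_n, Arith Mod R_j R_m R_n, Const R_c 0,
     IfLess R_m R_one (Const R_c 1) Skip,
     IfLess R_zero R_i (seq [Arith Minus R_x R_m R_n, follow Skip]) Skip,
     IfLess R_zero R_j (seq [Arith Minus R_x R_m R_one, follow (Arith Plus R_x R_x R_two)]) Skip,
     Arith Plus R_x R_rbase R_m, Store R_x R_c, incr R_m]"

definition report_target :: com where
  "report_target = seq [Arith Plus R_x R_rbase R_target, Load R_x R_x,
     IfLess R_zero R_x (Report R_a R_b) Skip]"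

definition search_target :: com where
  "search_target = Seq (Const R_m 0) (Seq (WhileLess R_m R_nn reach_step) report_target)"

definition fetch_target :: com where
  "fetch_target = seq [Arith Div R_a R_target R_n, Arith Mod R_b R_target R_n,
     fetch R_a R_pp R_pt R_pv, fetch R_b R_rp R_rt R_rv, Arith Plus R_x R_pt R_rt]"

text \<open>Only targets with the event of process 0 in first place are tried, as a report in either
  order counts for completeness.\<close>

definition search :: com where
  "search = Seq (Const R_target 0) (WhileLess R_target R_nn
     (Seq fetch_target
     (Seq (IfLess R_pp R_one (IfLess R_zero R_rp (if_eq R_pv R_rv
        (IfLess R_x R_two search_target Skip) Skip) Skip) Skip)
       (incr R_target))))"

text \<open>For inputs with \<open>2 <= k\<close> the test \<open>k < 3\<close> singles out
  \<open>k = 2\<close>. \<open>R_n\<close> holds \<open>k\<close> just for this test and is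
  overwritten by \<open>init_regs\<close>.\<close>

definition race_program :: com where
  "race_program = Seq (seq [Const R_three 3, Load R_n R_zero])
     (IfLess R_n R_three (Seq init_regs (Seq tabulate search)) Skip)"

section \<open>Correctness of the table of thresholds\<close>

definition ty :: "event \<Rightarrow> nat" where
  "ty e = encode_action (action e) ! 0"

definition num :: "event \<Rightarrow> nat" where
  "num e = encode_action (action e) ! 1"

definition input_at :: "event list \<Rightarrow> (nat \<Rightarrow> nat) \<Rightarrow> bool" where
  "input_at t M \<longleftrightarrow> (\<forall>p < length t. M (4 + 3 * p) = proc (t ! p) \<and>
     M (5 + 3 * p) = ty (t ! p) \<and> M (6 + 3 * p) = num (t ! p))"

definition const_regs :: "nat \<Rightarrow> (nat \<Rightarrow> nat) \<Rightarrow> bool" where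
  "const_regs n R \<longleftrightarrow> R R_zero = 0 \<and> R R_one = 1 \<and> R R_two = 2 \<and> R R_three = 3 \<and> R R_four = 4 \<and>
     R R_n = n \<and> R R_base = 4 + 3 * n \<and> R R_nn = n * n \<and> R R_nn2 = 2 * (n * n) \<and>
     R R_rbase = 4 + 3 * n + 4 * (n * n)"

text \<open>Whether the last write to variable \<open>v\<close> before position \<open>r\<close> has been executed at \<open>(i, j)\<close>.\<close>

fun seen :: "event list \<Rightarrow> nat \<Rightarrow> nat \<Rightarrow> nat \<Rightarrow> nat \<Rightarrow> bool" where
  "seen t i j v 0 \<longleftrightarrow> False"
| "seen t i j v (Suc r) \<longleftrightarrow> (if action (t ! r) = Write v then inS t i j r else seen t i j v r)"

text \<open>These are the reads whose value a write to \<open>v\<close> would destroy at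
  \<open>(i, j)\<close>. Each forbids the write for exactly the targets that contain it.\<close>

definition late_read :: "event list \<Rightarrow> nat \<Rightarrow> nat \<Rightarrow> nat \<Rightarrow> nat \<Rightarrow> bool" where
  "late_read t i j v r \<longleftrightarrow> action (t ! r) = Read v \<and> \<not> inS t i j r \<and> seen t i j v r"

definition count :: "event list \<Rightarrow> nat \<Rightarrow> nat \<Rightarrow> action \<Rightarrow> nat \<Rightarrow> nat" where
  "count t i j c r = card {r'. r' < r \<and> action (t ! r') = c \<and> inS t i j r'}"

lemma count_0 [simp]: "count t i j c 0 = 0"
  by (simp add: count_def)

lemma count_Suc [simp]:
  "count t i j c (Suc r) = count t i j c r + of_bool (action (t ! r) = c \<and> inS t i j r)"
proof -
  have "{r'. r' < Suc r \<and> action (t ! r') = c \<and> inS t i j r'} =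
    (if action (t ! r) = c \<and> inS t i j r then insert r else id)
      {r'. r' < r \<and> action (t ! r') = c \<and> inS t i j r'}"
    by (auto simp: less_Suc_eq)
  then show ?thesis by (simp add: count_def)
qed

lemma done_at_iff:
  "distinct t \<Longrightarrow> r < length t \<Longrightarrow> t ! r \<in> done_at t i j \<longleftrightarrow> inS t i j r"
  by (auto simp: done_at_def nth_eq_iff_index_eq)

lemma seen_iff:
  assumes "distinct t" "r \<le> length t"
  shows "seen t i j v r \<longleftrightarrow>
    (let ws = filter (\<lambda>w. action w = Write v) (take r t) in ws \<noteq> [] \<and> last ws \<in> done_at t i j)"
  using assms(2)
proof (induction r)
  case (Suc r)
  then show ?case
    using done_at_iff[OF assms(1), of r i j] by (simp add: take_Suc_conv_app_nth Let_def)
qed simp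

text \<open>The program never computes observations: when a left-to-right scan arrives at a read,
  the last write it has passed on that variable is the observed one.\<close>

lemma seen_read:
  assumes t: "is_trace t" and r: "r < length t" "action (t ! r) = Read v"
  shows "seen t i j v r \<longleftrightarrow> obs t (t ! r) \<in> done_at t i j"
proof -
  have d: "distinct t" using t by (simp add: is_trace_def)
  let ?ws = "filter (\<lambda>w. action w = Write v) (take r t)"
  have e: "(writes w \<and> loc w = loc (t ! r)) = (action w = Write v)" for w
    using r by (cases "action w") auto
  have split: "t = take r t @ t ! r # drop (Suc r) t" using r by (simp add: id_take_nth_drop)
  have ni: "t ! r \<notin> set (take r t)"
    using d r by (auto simp: in_set_conv_nth nth_eq_iff_index_eq)
  have o: "obs t (t ! r) = last ?ws"
    using obs_append[OF ni, of "drop (Suc r) t", folded split] unfolding e .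
  \<comment> \<open>Without any earlier write \<open>seen\<close> is False while
    \<open>last []\<close> is unspecified, so this case has to be excluded.\<close>
  have "?ws \<noteq> []"
  proof -
    obtain w where w: "writes w" "loc w = loc (t ! r)" "before t w (t ! r)"
      using obs_write[OF t, of "t ! r"] r by auto
    obtain x y where xy: "x < y" "y < length t" "t ! x = w" "t ! y = t ! r"
      using w(3) unfolding before_def by blast
    then have "y = r" using d r by (simp add: nth_eq_iff_index_eq)
    then have "w \<in> set (take r t)" using xy by (auto simp: in_set_conv_nth intro!: exI[of _ x])
    moreover have "action w = Write v" using e w by blast
    ultimately show ?thesis by (auto simp: filter_empty_conv)
  qed
  then show ?thesis using seen_iff[OF d, of r] r o by (simp add: Let_def)
qed

lemma card_done_at:
  assumes "distinct t"
  shows "card {e \<in> done_at t i j. action e = c} = count t i j c (length t)"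
proof -
  let ?I = "{r. r < length t \<and> action (t ! r) = c \<and> inS t i j r}"
  have "{e \<in> done_at t i j. action e = c} = (!) t ` ?I"
    unfolding done_at_def by blast
  moreover have "inj_on ((!) t) ?I"
    by (rule inj_on_nth[OF assms]) simp
  ultimately show ?thesis unfolding count_def by (simp only: card_image)
qed

text \<open>All sets are replaced by quantities that a scan over positions can maintain. The target
  \<open>a\<close>, \<open>b\<close> survives in the \<open>Write\<close> case only, which is why
  one table serves all targets.\<close>

lemma allowed_iff:
  assumes t: "is_trace t" and p: "p < length t"
  shows "allowed t (done_at t a b) (done_at t i j) (t ! p) \<longleftrightarrow>
    (case action (t ! p) of
       Write v \<Rightarrow> \<forall>r < length t. late_read t i j v r \<longrightarrow> \<not> inS t a b r
     | Read v \<Rightarrow> seen t i j v p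
     | Acquire l \<Rightarrow> count t i j (Acquire l) (length t) \<le> count t i j (Release l) (length t)
     | Release l \<Rightarrow> True)"
proof -
  have d: "distinct t" using t by (simp add: is_trace_def)
  show ?thesis
  proof (cases "action (t ! p)")
    case (Write v)
    have rd: "reads r \<and> loc r = loc (t ! p) \<longleftrightarrow> action r = Read v" for r
      using Write by (cases "action r") auto
    let ?D = "done_at t i j"
    have "allowed t (done_at t a b) ?D (t ! p) \<longleftrightarrow>
      (\<forall>e \<in> done_at t a b. e \<notin> ?D \<longrightarrow> action e = Read v \<longrightarrow> obs t e \<notin> ?D)"
      unfolding allowed_def rd using Write by auto
    also have "\<dots> \<longleftrightarrow> (\<forall>r < length t. inS t a b r \<longrightarrow> t ! r \<notin> ?D \<longrightarrow>
        action (t ! r) = Read v \<longrightarrow> obs t (t ! r) \<notin> ?D)"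
      unfolding done_at_def[of t a b] by auto
    also have "\<dots> \<longleftrightarrow> (\<forall>r < length t. late_read t i j v r \<longrightarrow> \<not> inS t a b r)"
    proof -
      have "late_read t i j v r \<longleftrightarrow>
          t ! r \<notin> ?D \<and> action (t ! r) = Read v \<and> obs t (t ! r) \<in> ?D" if "r < length t" for r
        using seen_read[OF t that, of v i j] done_at_iff[OF d that, of i j]
        unfolding late_read_def by auto
      then show ?thesis by auto
    qed
    finally show ?thesis using Write by simp
  next
    case (Read v)
    then show ?thesis using seen_read[OF t p Read] by (simp add: allowed_def)
  next
    case (Acquire l)
    have *: "acquires e \<and> loc e = loc (t ! p) \<longleftrightarrow> action e = Acquire l"
      "releases e \<and> loc e = loc (t ! p) \<longleftrightarrow> action e = Release l" for e
      using Acquire by (cases "action e"; auto)+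
    show ?thesis unfolding allowed_def * card_done_at[OF d] using Acquire by simp
  next
    case (Release l)
    then show ?thesis by (simp add: allowed_def)
  qed
qed

section \<open>Verification of the scan for one step\<close>

lemma wp_seq_Cons:
  "wp W c P s \<Longrightarrow> (\<And>s. P s \<Longrightarrow> wp W (seq cs) Q s) \<Longrightarrow> wp W (seq (c # cs)) Q s"
  by (auto elim: wp_mono)

lemma const_regs_upd [simp]: "11 \<le> x \<Longrightarrow> const_regs n (R(x := v)) \<longleftrightarrow> const_regs n R"
  by (auto simp: const_regs_def)

lemma const_regsD:
  assumes "const_regs n R"
  shows "R R_zero = 0" "R R_one = 1" "R R_two = 2" "R R_three = 3" "R R_four = 4" "R R_n = n"
    "R R_base = 4 + 3 * n" "R R_nn = n * n" "R R_nn2 = 2 * (n * n)"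
    "R R_rbase = 4 + 3 * n + 4 * (n * n)"
  using assms by (simp_all add: const_regs_def)

lemma input_at_upd [simp]:
  "4 + 3 * length t \<le> x \<Longrightarrow> input_at t (M(x := v)) \<longleftrightarrow> input_at t M"
  by (auto simp: input_at_def)

lemma wp_fetch:
  assumes "const_regs n (reg s)" "input_at t (mem s)" "n = length t" "reg s p < n"
    and "3 * n + 20 \<le> W"
    and "distinct [R_x, rp, rt, rv]" "11 \<le> rp" "11 \<le> rt" "11 \<le> rv"
    and "Q (s\<lparr>reg := (reg s)(R_x := 6 + 3 * reg s p, rp := proc (t ! reg s p),
           rt := ty (t ! reg s p), rv := num (t ! reg s p))\<rparr>)"
  shows "wp W (fetch p rp rt rv) Q s"
proof -
  note c = const_regsD[OF assms(1)]
  define P where "P = reg s p"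
  have m: "mem s (4 + 3 * P) = proc (t ! P)" "mem s (5 + 3 * P) = ty (t ! P)"
    "mem s (6 + 3 * P) = num (t ! P)"
    using assms(2,3,4) by (simp_all add: input_at_def P_def)
  have d: "rp \<noteq> R_x" "rt \<noteq> R_x" "rv \<noteq> R_x" "rp \<noteq> rt" "rp \<noteq> rv" "rt \<noteq> rv"
    "rp \<noteq> R_one" "rt \<noteq> R_one" using assms(6-9) by auto
  have W: "3 * P + 10 < W" using assms(4,5) by (simp add: P_def)
  show ?thesis
    unfolding fetch_def
    using d W assms(10) unfolding P_def[symmetric]
    by (simp add: c m m[unfolded add.commute[of _ "3 * P"]] fun_upd_twist flip: P_def)
qed

definition thr :: "event list \<Rightarrow> nat \<Rightarrow> nat \<Rightarrow> nat \<Rightarrow> bool \<Rightarrow> nat \<Rightarrow> nat \<Rightarrow> bool" where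
  "thr t i j v first r a \<longleftrightarrow>
     (\<forall>r' < r. late_read t i j v r' \<and> (proc (t ! r') = 0 \<longleftrightarrow> first) \<longrightarrow> a \<le> r')"

lemma thr_0 [simp]: "thr t i j v first 0 a"
  by (simp add: thr_def)

lemma thr_Suc [simp]: "thr t i j v first (Suc r) a \<longleftrightarrow> thr t i j v first r a \<and>
    (late_read t i j v r \<and> (proc (t ! r) = 0 \<longleftrightarrow> first) \<longrightarrow> a \<le> r)"
  by (auto simp: thr_def less_Suc_eq)

text \<open>The threshold is specified by the values below it and not as a minimum. This also covers
  the case without late reads, where it stays at \<open>length t\<close>.\<close>

definition cut :: "event list \<Rightarrow> nat \<Rightarrow> nat \<Rightarrow> nat \<Rightarrow> bool \<Rightarrow> nat \<Rightarrow> nat \<Rightarrow> bool" where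
  "cut t i j v first r A \<longleftrightarrow> (\<forall>a. a < A \<longleftrightarrow> a < length t \<and> thr t i j v first r a)"

lemma cut_0 [simp]: "cut t i j v first 0 (length t)"
  by (simp add: cut_def)

lemma cut_skip:
  "cut t i j v first r A \<Longrightarrow> \<not> (late_read t i j v r \<and> (proc (t ! r) = 0 \<longleftrightarrow> first)) \<Longrightarrow>
   cut t i j v first (Suc r) A"
  unfolding cut_def thr_Suc by blast

lemma cut_hit:
  assumes "cut t i j v first r A" "late_read t i j v r" "proc (t ! r) = 0 \<longleftrightarrow> first"
  shows "cut t i j v first (Suc r) (if Suc r < A then Suc r else A)"
  unfolding cut_def
proof
  fix a
  have "a < A \<longleftrightarrow> a < length t \<and> thr t i j v first r a" using assms(1) unfolding cut_def by blast
  moreover have "thr t i j v first (Suc r) a \<longleftrightarrow> thr t i j v first r a \<and> a < Suc r"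
    using assms(2,3) by (simp add: less_Suc_eq_le)
  moreover have "a < (if Suc r < A then Suc r else A) \<longleftrightarrow> a < A \<and> a < Suc r" by auto
  ultimately show "a < (if Suc r < A then Suc r else A) \<longleftrightarrow>
    a < length t \<and> thr t i j v first (Suc r) a" by blast
qed

lemma cut_le: "cut t i j v first r A \<Longrightarrow> A \<le> length t"
  unfolding cut_def using not_le by blast

lemma count_le: "count t i j c r \<le> r"
proof -
  have "{r'. r' < r \<and> action (t ! r') = c \<and> inS t i j r'} \<subseteq> {..<r}" by auto
  from card_mono[OF _ this] show ?thesis by (simp add: count_def)
qed

lemma ty_num:
  "action e = Write x \<Longrightarrow> ty e = 0 \<and> num e = x"
  "action e = Read x \<Longrightarrow> ty e = 1 \<and> num e = x"
  "action e = Acquire x \<Longrightarrow> ty e = 2 \<and> num e = x"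
  "action e = Release x \<Longrightarrow> ty e = 3 \<and> num e = x"
  by (simp_all add: ty_def num_def)

text \<open>\<open>R_g\<close> is a snapshot of \<open>R_f\<close> taken when the scan passes
  \<open>p\<close>, hence the conjunct \<open>p < r\<close>. \<open>M\<close> and \<open>O'\<close>
  freeze the memory and the output, which the scan does not change.\<close>

definition scan_inv :: "event list \<Rightarrow> nat \<Rightarrow> nat \<Rightarrow> nat \<Rightarrow> nat \<Rightarrow> nat \<Rightarrow> (nat \<Rightarrow> nat) \<Rightarrow>
    (nat \<times> nat) list \<Rightarrow> nat \<Rightarrow> state \<Rightarrow> bool" where
  "scan_inv t i j p q m M O' r s \<longleftrightarrow>
     (let n = length t; v = num (t ! p); R = reg s in
     const_regs n R \<and> mem s = M \<and> out s = O' \<and> R R_m = m \<and> R R_q = q \<and>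
     R R_i = i \<and> R R_j = j \<and> R R_p = p \<and> R R_pp = proc (t ! p) \<and> R R_pt = ty (t ! p) \<and> R R_pv = v \<and>
     R R_r = r \<and> R R_f = of_bool (seen t i j v r) \<and>
     R R_g = of_bool (action (t ! p) = Read v \<and> p < r \<and> seen t i j v p) \<and>
     cut t i j v True r (R R_A) \<and> cut t i j v False r (R R_B) \<and>
     R R_acq = count t i j (Acquire v) r \<and> R R_rel = count t i j (Release v) r)"

definition scan_mid :: "event list \<Rightarrow> nat \<Rightarrow> nat \<Rightarrow> nat \<Rightarrow> state \<Rightarrow> bool" where
  "scan_mid t i j r s \<longleftrightarrow> reg s R_rp = proc (t ! r) \<and> reg s R_rt = ty (t ! r) \<and>
     reg s R_rv = num (t ! r) \<and> reg s R_s = of_bool (inS t i j r)"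

lemma wp_scan_position:
  assumes I: "scan_inv t i j p q m M O' r s" and r: "r < length t"
    and M: "input_at t M" and W: "3 * length t + 20 \<le> W"
  shows "wp W scan_position (\<lambda>s. scan_inv t i j p q m M O' r s \<and> scan_mid t i j r s) s"
proof -
  have c: "const_regs (length t) (reg s)" and [simp]: "reg s R_r = r" "mem s = M"
    using I by (simp_all add: scan_inv_def Let_def)
  note [simp] = const_regsD[OF c]
  show ?thesis
    unfolding scan_position_def
  proof (rule wp_seq_Cons)
    show "wp W (fetch R_r R_rp R_rt R_rv) (\<lambda>s. scan_inv t i j p q m M O' r s \<and>
        reg s R_rp = proc (t ! r) \<and> reg s R_rt = ty (t ! r) \<and> reg s R_rv = num (t ! r)) s"
      by (rule wp_fetch[OF c _ refl]) (use I r M W in \<open>simp_all add: scan_inv_def Let_def\<close>)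
  next
    fix s
    assume *: "scan_inv t i j p q m M O' r s \<and>
        reg s R_rp = proc (t ! r) \<and> reg s R_rt = ty (t ! r) \<and> reg s R_rv = num (t ! r)"
    then have c: "const_regs (length t) (reg s)" and
      [simp]: "reg s R_r = r" "reg s R_i = i" "reg s R_j = j" "reg s R_rp = proc (t ! r)"
      by (simp_all add: scan_inv_def Let_def)
    show "wp W (seq [Const R_s 0, IfLess R_rp R_one (IfLess R_r R_i (Const R_s 1) Skip)
        (IfLess R_r R_j (Const R_s 1) Skip)])
      (\<lambda>s. scan_inv t i j p q m M O' r s \<and> scan_mid t i j r s) s"
      using * W by (simp add: const_regsD[OF c] scan_inv_def scan_mid_def Let_def inS_def)
  qed
qed

lemma wp_scan_update:
  assumes I: "scan_inv t i j p q m M O' r s" and mid: "scan_mid t i j r s" and r: "r < length t"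
    and W: "3 * length t + 20 \<le> W"
  shows "wp W scan_update (scan_inv t i j p q m M O' (Suc r)) s"
proof -
  have c: "const_regs (length t) (reg s)"
    using I by (simp add: scan_inv_def Let_def)
  note [simp] = const_regsD[OF c]
  define v where "v = num (t ! p)"
  have rW: "Suc r < W" "r < W" "0 < W" using r W by simp_all
  have cW: "count t i j a r + of_bool b < W" for a b
    using count_le[of t i j a r] r W by simp
  have cW': "count t i j a r < W" for a
    using count_le[of t i j a r] r W by simp
  have cA: "cut t i j v True r (reg s R_A)" and cB: "cut t i j v False r (reg s R_B)"
    using I by (simp_all add: scan_inv_def Let_def v_def)
  note defs = scan_update_def if_eq_def scan_inv_def scan_mid_def Let_def less_Suc_eq ty_num v_def[symmetric]
  have skip: "cut t i j v True (Suc r) (reg s R_A)" "cut t i j v False (Suc r) (reg s R_B)"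
    if "\<not> late_read t i j v r"
    using cut_skip[OF cA] cut_skip[OF cB] that by blast+
  show ?thesis
  proof (cases "late_read t i j v r")
    case True
    have rd: "action (t ! r) = Read v" "\<not> inS t i j r" "seen t i j v r"
      using True by (simp_all add: late_read_def)
    show ?thesis
    proof (cases "proc (t ! r) = 0")
      case first: True
      have "cut t i j v True (Suc r) (if Suc r < reg s R_A then Suc r else reg s R_A)"
        "cut t i j v False (Suc r) (reg s R_B)"
        using cut_hit[OF cA True] cut_skip[OF cB] first by simp_all
      then show ?thesis
        using I mid rW rd first cut_le[OF cA] W
        by (cases "r = p"; cases "Suc r < reg s R_A"; simp add: defs)
    next
      case first: False
      have "cut t i j v False (Suc r) (if Suc r < reg s R_B then Suc r else reg s R_B)"
        "cut t i j v True (Suc r) (reg s R_A)"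
        using cut_hit[OF cB True] cut_skip[OF cA] first by simp_all
      then show ?thesis
        using I mid rW rd first cut_le[OF cB] W
        by (cases "r = p"; cases "Suc r < reg s R_B"; simp add: defs)
    qed
  next
    case False
    note sk = skip[OF False]
    show ?thesis
    proof (cases "action (t ! r)")
      case (Write v')
      then show ?thesis using I mid rW sk by (cases "v' = v"; simp add: defs)
    next
      case (Read v')
      from False Read consider "v' \<noteq> v" | "v' = v" "inS t i j r" | "v' = v" "\<not> inS t i j r" "\<not> seen t i j v r"
        by (auto simp: late_read_def)
      then show ?thesis
      proof cases
        case 1
        \<comment> \<open>\<open>v\<close> is the number of the event at \<open>p\<close>. A read
          with another number is not that event, so the condition tracked by \<open>R_g\<close> does
          not change here.\<close>
        then have "r \<noteq> p" using Read by (auto simp: v_def ty_num)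
        then show ?thesis using 1 I mid rW sk Read by (simp add: defs)
      next
        case 2
        then show ?thesis using I mid rW sk Read by (cases "r = p"; simp add: defs)
      next
        case 3
        then show ?thesis using I mid rW sk Read by (cases "r = p"; simp add: defs)
      qed
    next
      case (Acquire l)
      then show ?thesis using I mid rW cW cW' sk
        by (cases "l = v"; simp add: defs)
    next
      case (Release l)
      then show ?thesis using I mid rW cW cW' sk
        by (cases "l = v"; simp add: defs)
    qed
  qed
qed

lemma run_scan:
  assumes I: "scan_inv t i j p q m M O' 0 s" and M: "input_at t M" and W: "3 * length t + 20 \<le> W"
  shows "run W (Suc (length t) * 100) scan (scan_inv t i j p q m M O' (length t)) s"
proof -
  have "run W (Suc (length t - 0) * Suc (cost scan_position + cost scan_update)) scan
      (scan_inv t i j p q m M O' (length t)) s"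
    unfolding scan_def
  proof (rule run_while)
    show "reg s R_r = k \<and> reg s R_n = length t" if "scan_inv t i j p q m M O' k s" for k s
      using that by (simp add: scan_inv_def Let_def const_regs_def)
  next
    fix r s assume r: "r < length t" and I: "scan_inv t i j p q m M O' r s"
    show "run W (cost scan_position + cost scan_update) (Seq scan_position scan_update)
        (scan_inv t i j p q m M O' (Suc r)) s"
    proof (rule run_Seq, rule run_mono[OF run_wp[OF wp_scan_position[OF I r M W]] order_refl])
      fix s assume "scan_inv t i j p q m M O' r s \<and> scan_mid t i j r s"
      then show "run W (cost scan_update) scan_update (scan_inv t i j p q m M O' (Suc r)) s"
        using run_wp wp_scan_update r W by blast
    qed
  qed (use I in auto)
  \<comment> \<open>100 is a round bound for one iteration including its test.\<close>
  moreover have "Suc (cost scan_position + cost scan_update) \<le> 100"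
    by (simp add: scan_position_def scan_update_def fetch_def if_eq_def)
  ultimately show ?thesis
    using run_mono mult_le_mono2[of _ 100 "Suc (length t)"] by (metis diff_zero)
qed

section \<open>Filling the table for all steps\<close>

definition table :: "event list \<Rightarrow> nat \<Rightarrow> (nat \<Rightarrow> nat) \<Rightarrow> bool" where
  "table t k M \<longleftrightarrow> (\<forall>m < k. \<forall>a b.
     a < M (4 + 3 * length t + 2 * m) \<and> b < M (4 + 3 * length t + (2 * m + 1)) \<longleftrightarrow>
     a < length t \<and> b < length t \<and>
     enabled t a b (m mod 2) (m div 2 div length t) (m div 2 mod length t))"

lemma table_upd: "4 + 3 * length t + 2 * k \<le> x \<Longrightarrow> table t k (M(x := v)) \<longleftrightarrow> table t k M"
  by (simp add: table_def)

lemma table_Suc: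
  "table t (Suc k) M \<longleftrightarrow> table t k M \<and> (\<forall>a b.
     a < M (4 + 3 * length t + 2 * k) \<and> b < M (4 + 3 * length t + (2 * k + 1)) \<longleftrightarrow>
     a < length t \<and> b < length t \<and>
     enabled t a b (k mod 2) (k div 2 div length t) (k div 2 mod length t))"
  unfolding table_def less_Suc_eq by blast

definition decided :: "event list \<Rightarrow> nat \<Rightarrow> nat \<Rightarrow> nat \<Rightarrow> nat \<Rightarrow> (nat \<Rightarrow> nat) \<Rightarrow>
    (nat \<times> nat) list \<Rightarrow> state \<Rightarrow> bool" where
  "decided t i j q m M O' s \<longleftrightarrow>
     const_regs (length t) (reg s) \<and> mem s = M \<and> out s = O' \<and> reg s R_m = m \<and>
     (\<forall>a b. a < reg s R_A \<and> b < reg s R_B \<longleftrightarrow> a < length t \<and> b < length t \<and> enabled t a b q i j)"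

lemma cut_enabled_write:
  assumes t: "is_trace t" and p: "p = (if q = 0 then i else j)" "p < length t" "proc (t ! p) = q"
    and w: "action (t ! p) = Write v"
    and A: "cut t i j v True (length t) A" and B: "cut t i j v False (length t) B"
  shows "a < A \<and> b < B \<longleftrightarrow> a < length t \<and> b < length t \<and> enabled t a b q i j"
proof -
  have "enabled t a b q i j \<longleftrightarrow> (\<forall>r < length t. late_read t i j v r \<longrightarrow> \<not> inS t a b r)"
    unfolding enabled_def Let_def p(1)[symmetric] allowed_iff[OF t p(2)] using p(3) w by simp
  also have "\<dots> \<longleftrightarrow> thr t i j v True (length t) a \<and> thr t i j v False (length t) b"
    unfolding thr_def inS_def not_less by (auto split: if_splits)
  finally show ?thesis using A B unfolding cut_def by blast
qed

lemma wp_step_decide: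
  assumes t: "is_trace t" and I: "scan_inv t i j p q m M O' (length t) s"
    and p: "p = (if q = 0 then i else j)" "p < length t"
    and W: "3 * length t + 20 \<le> W"
  shows "wp W step_decide (decided t i j q m M O') s"
proof -
  have c: "const_regs (length t) (reg s)" and st: "mem s = M" "out s = O'" "reg s R_m = m" "reg s R_q = q"
    "reg s R_pp = proc (t ! p)" "reg s R_pt = ty (t ! p)"
    and g: "reg s R_g = of_bool (action (t ! p) = Read (num (t ! p)) \<and> seen t i j (num (t ! p)) p)"
    and A: "cut t i j (num (t ! p)) True (length t) (reg s R_A)"
    and B: "cut t i j (num (t ! p)) False (length t) (reg s R_B)"
    and cnt: "reg s R_acq = count t i j (Acquire (num (t ! p))) (length t)"
      "reg s R_rel = count t i j (Release (num (t ! p))) (length t)"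
    using I p(2) by (simp_all add: scan_inv_def Let_def)
  note [simp] = const_regsD[OF c] st
  have W': "length t < W" "0 < W" using W by simp_all
  have free: "wp W free (decided t i j q m M O') s" if "\<And>a b. enabled t a b q i j"
    using that c W' by (simp add: free_def decided_def)
  have blocked: "wp W blocked (decided t i j q m M O') s" if "\<And>a b. \<not> enabled t a b q i j"
    using that c W' by (simp add: blocked_def decided_def)
  show ?thesis
  proof (cases "proc (t ! p) = q")
    case False
    then have "enabled t a b q i j" for a b using p(1) by (auto simp: enabled_def)
    from free[OF this] show ?thesis using False by (auto simp: step_decide_def if_eq_def)
  next
    case q: True
    have en: "enabled t a b q i j \<longleftrightarrow> allowed t (done_at t a b) (done_at t i j) (t ! p)" for a b
      unfolding enabled_def Let_def p(1)[symmetric] using q by simp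
    note en = en[unfolded allowed_iff[OF t p(2)]]
    show ?thesis
    proof (cases "action (t ! p)")
      case (Write v)
      then have "ty (t ! p) = 0" "num (t ! p) = v" by (simp_all add: ty_num)
      then show ?thesis
        using cut_enabled_write[OF t p q Write] A B q c
        by (simp add: step_decide_def if_eq_def decided_def)
    next
      case (Read v)
      then have v: "ty (t ! p) = 1" "num (t ! p) = v" by (simp_all add: ty_num)
      show ?thesis
      proof (cases "seen t i j v p")
        case True
        have "wp W free (decided t i j q m M O') s" by (rule free) (use en Read True in simp)
        then show ?thesis using v q g Read True by (simp add: step_decide_def if_eq_def)
      next
        case False
        have "wp W blocked (decided t i j q m M O') s" by (rule blocked) (use en Read False in simp)
        then show ?thesis using v q g Read False by (simp add: step_decide_def if_eq_def)
      qed
    next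
      case (Acquire l)
      then have v: "ty (t ! p) = 2" "num (t ! p) = l" by (simp_all add: ty_num)
      show ?thesis
      proof (cases "count t i j (Acquire l) (length t) \<le> count t i j (Release l) (length t)")
        case True
        have "wp W free (decided t i j q m M O') s" by (rule free) (use en Acquire True in simp)
        then show ?thesis using v q cnt True by (simp add: step_decide_def if_eq_def)
      next
        case False
        have "wp W blocked (decided t i j q m M O') s" by (rule blocked) (use en Acquire False in simp)
        then show ?thesis using v q cnt False by (simp add: step_decide_def if_eq_def)
      qed
    next
      case (Release l)
      then have v: "ty (t ! p) = 3" by (simp add: ty_num)
      have "wp W free (decided t i j q m M O') s" by (rule free) (use en Release in simp)
      then show ?thesis using v q by (simp add: step_decide_def if_eq_def)
    qed
  qed
qed

definition tab_inv :: "event list \<Rightarrow> nat \<Rightarrow> state \<Rightarrow> bool" where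
  "tab_inv t k s \<longleftrightarrow> const_regs (length t) (reg s) \<and> input_at t (mem s) \<and> table t k (mem s) \<and>
     out s = [] \<and> reg s R_m = k"

lemma wp_step_store:
  assumes D: "decided t (k div 2 div length t) (k div 2 mod length t) (k mod 2) k M [] s"
    and M: "input_at t M" "table t k M" and k: "k < 2 * (length t * length t)"
    and W: "5 * (length t * length t) + 3 * length t + 20 \<le> W"
  shows "wp W step_store (tab_inv t (Suc k)) s"
proof -
  define n where "n = length t"
  have c: "const_regs n (reg s)" and st: "mem s = M" "out s = []" "reg s R_m = k"
    using D by (simp_all add: decided_def n_def)
  note [simp] = const_regsD[OF c] st
  have W': "2 * k + 3 * n + 6 < W" using W k by (simp add: n_def)
  let ?x = "4 + 3 * n + 2 * k"
  let ?M = "M(?x := reg s R_A, Suc ?x := reg s R_B)"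
  have "table t (Suc k) ?M"
    unfolding table_Suc using D M(2) by (simp add: decided_def table_upd n_def)
  moreover have "input_at t ?M" using M(1) by (simp add: n_def)
  ultimately show ?thesis
    unfolding step_store_def tab_inv_def n_def[symmetric]
    using c W' by (simp add: mult_2[symmetric])
qed

lemma wp_seq_append: "wp W (seq (cs @ ds)) Q s \<longleftrightarrow> wp W (seq cs) (wp W (seq ds) Q) s"
  by (induction cs arbitrary: s) (auto elim!: wp_mono)

lemma wp_step_init:
  assumes I: "tab_inv t k s" and k: "k < 2 * (length t * length t)"
    and W: "5 * (length t * length t) + 3 * length t + 20 \<le> W"
    and ij: "i = k div 2 div length t" "j = k div 2 mod length t" "q = k mod 2"
    and p: "p = (if q = 0 then i else j)"
  shows "wp W step_init (scan_inv t i j p q k (mem s) [] 0) s" and "p < length t"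
proof -
  define n where "n = length t"
  have k2: "k div 2 < n * n" using k by (simp add: n_def)
  then have n: "0 < n" by (cases n) auto
  have lt: "i < n" "j < n"
    using k2 n less_mult_imp_div_less[of "k div 2" n n] by (simp_all add: ij n_def)
  then show pn: "p < length t" using p by (simp add: n_def)
  define M where "M = mem s"
  define P where "P \<equiv> \<lambda>s :: state. const_regs n (reg s) \<and> mem s = M \<and> out s = [] \<and> reg s R_m = k \<and>
    reg s R_q = q \<and> reg s R_i = i \<and> reg s R_j = j \<and> reg s R_p = p"
  have c: "const_regs n (reg s)" and st: "reg s R_m = k" "mem s = M" "out s = []"
    and M: "input_at t M"
    using I by (simp_all add: tab_inv_def n_def M_def)
  have W': "k div 2 < W" "i < W" "j < W" "n < W" "3 * n + 20 \<le> W" "k mod 2 < W" "0 < W"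
    using W k2 lt by (simp_all add: n_def)
  have split: "step_init = seq ([Arith Mod R_q R_m R_two, Arith Div R_x R_m R_two,
     Arith Div R_i R_x R_n, Arith Mod R_j R_x R_n,
     IfLess R_q R_one (move R_p R_i) (move R_p R_j)] @ (fetch R_p R_pp R_pt R_pv #
     [Const R_f 0, Const R_g 0, move R_A R_n, move R_B R_n, Const R_acq 0, Const R_rel 0, Const R_r 0]))"
    (is "_ = seq (?cs @ (fetch _ _ _ _ # ?ds))")
    by (simp add: step_init_def)
  have fst: "wp W (seq ?cs) P s"
    using c st lt W' by (simp add: P_def const_regsD[OF c] p ij(3) ij(1,2)[folded n_def, symmetric])
  have snd: "wp W (seq (fetch R_p R_pp R_pt R_pv # ?ds)) (scan_inv t i j p q k M [] 0) s"
    if "P s" for s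
  proof (rule wp_seq_Cons)
    have c: "const_regs n (reg s)" using that by (simp add: P_def)
    show "wp W (fetch R_p R_pp R_pt R_pv) (\<lambda>s. P s \<and> reg s R_pp = proc (t ! p) \<and>
        reg s R_pt = ty (t ! p) \<and> reg s R_pv = num (t ! p)) s"
      by (rule wp_fetch[OF c _ n_def]) (use that pn M W' in \<open>simp_all add: P_def n_def\<close>)
  next
    fix s assume *: "P s \<and> reg s R_pp = proc (t ! p) \<and>
        reg s R_pt = ty (t ! p) \<and> reg s R_pv = num (t ! p)"
    then have c: "const_regs n (reg s)" by (simp add: P_def)
    show "wp W (seq ?ds) (scan_inv t i j p q k M [] 0) s"
      using * W' c by (simp add: P_def scan_inv_def Let_def const_regsD[OF c] n_def)
  qed
  show "wp W step_init (scan_inv t i j p q k (mem s) [] 0) s"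
    unfolding M_def[symmetric] split wp_seq_append using fst by (rule wp_mono) (rule snd)
qed

lemma run_tabulate:
  assumes t: "is_trace t" and W: "5 * (length t * length t) + 3 * length t + 20 \<le> W"
    and s: "const_regs (length t) (reg s)" "input_at t (mem s)" "out s = []"
  shows "run W (Suc (2 * (length t * length t)) * (Suc (length t) * 200)) tabulate
    (tab_inv t (2 * (length t * length t))) s"
proof -
  let ?n = "length t"
  let ?b = "cost step_init + (Suc ?n * 100 + (cost step_decide + cost step_store))"
  have W3: "3 * ?n + 20 \<le> W" using W by simp
  have "run W (cost (Const R_m 0) + Suc (2 * (?n * ?n) - 0) * Suc ?b) tabulate
    (tab_inv t (2 * (?n * ?n))) s"
    unfolding tabulate_def
  proof (rule run_Seq, rule run_mono[OF run_wp order_refl])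
    show "wp W (Const R_m 0) (tab_inv t 0) s"
      using s W by (simp add: tab_inv_def table_def)
  next
    fix s assume "tab_inv t 0 s"
    then show "run W (Suc (2 * (?n * ?n) - 0) * Suc ?b)
       (WhileLess R_m R_nn2 (Seq step_init (Seq scan (Seq step_decide step_store))))
       (tab_inv t (2 * (?n * ?n))) s"
    proof (rule run_while)
      show "reg s R_m = k \<and> reg s R_nn2 = 2 * (?n * ?n)" if "tab_inv t k s" for k s
        using that const_regsD[of ?n "reg s"] by (simp add: tab_inv_def)
    next
      fix k s assume k: "k < 2 * (?n * ?n)" and I: "tab_inv t k s"
      define i j q p M where "i = k div 2 div ?n" and "j = k div 2 mod ?n" and "q = k mod 2"
        and "p = (if q = 0 then i else j)" and "M = mem s"
      note defs = i_def j_def q_def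
      have M: "input_at t M" "table t k M" using I by (simp_all add: tab_inv_def M_def)
      note init = wp_step_init[OF I k W defs p_def]
      show "run W ?b (Seq step_init (Seq scan (Seq step_decide step_store))) (tab_inv t (Suc k)) s"
      proof (rule run_Seq, rule run_mono[OF run_wp[OF init(1)[folded M_def]] order_refl])
        fix s assume "scan_inv t i j p q k M [] 0 s"
        then have "run W (Suc ?n * 100) scan (scan_inv t i j p q k M [] ?n) s"
          using run_scan M(1) W3 by blast
        then show "run W (Suc ?n * 100 + (cost step_decide + cost step_store))
          (Seq scan (Seq step_decide step_store)) (tab_inv t (Suc k)) s"
        proof (intro run_Seq, elim run_mono[OF _ order_refl])
          fix s assume "scan_inv t i j p q k M [] ?n s"
          from wp_step_decide[OF t this p_def init(2) W3]
          have "run W (cost step_decide) step_decide (decided t i j q k M []) s" by (rule run_wp)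
          then show "run W (cost step_decide + cost step_store) (Seq step_decide step_store)
            (tab_inv t (Suc k)) s"
          proof (intro run_Seq, elim run_mono[OF _ order_refl])
            fix s assume "decided t i j q k M [] s"
            from wp_step_store[OF this[unfolded defs] M k W]
            show "run W (cost step_store) step_store (tab_inv t (Suc k)) s" by (rule run_wp)
          qed
        qed
      qed
    qed simp
  qed
  moreover have "cost (Const R_m 0) + Suc (2 * (?n * ?n) - 0) * Suc ?b \<le>
     Suc (2 * (?n * ?n)) * (Suc ?n * 200)"
  proof -
    have "Suc (Suc ?b) \<le> Suc ?n * 200"
      by (simp add: step_init_def step_decide_def step_store_def free_def blocked_def fetch_def if_eq_def)
    then have "Suc (2 * (?n * ?n)) * Suc (Suc ?b) \<le> Suc (2 * (?n * ?n)) * (Suc ?n * 200)"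
      by (rule mult_le_mono2)
    \<comment> \<open>The unit spent before the loop is absorbed by charging one more unit per
      round.\<close>
    moreover have "1 + Suc x * y \<le> Suc x * Suc y" for x y :: nat by simp
    ultimately show ?thesis unfolding cost.simps diff_zero by (rule le_trans[rotated])
  qed
  ultimately show ?thesis by (rule run_mono)
qed

section \<open>Correctness of the search\<close>

definition reached :: "event list \<Rightarrow> nat \<Rightarrow> nat \<Rightarrow> nat \<Rightarrow> bool" where
  "reached t a b m \<longleftrightarrow> reach t a b (m div length t) (m mod length t)"

definition dp_inv :: "event list \<Rightarrow> nat \<Rightarrow> nat \<Rightarrow> nat \<Rightarrow> (nat \<times> nat) list \<Rightarrow> nat \<Rightarrow> state \<Rightarrow> bool" where
  "dp_inv t a b g O' k s \<longleftrightarrow> const_regs (length t) (reg s) \<and> input_at t (mem s) \<and>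
     table t (2 * (length t * length t)) (mem s) \<and> out s = O' \<and>
     reg s R_a = a \<and> reg s R_b = b \<and> reg s R_target = g \<and> reg s R_m = k \<and>
     (\<forall>m < k. mem s (4 + 3 * length t + 4 * (length t * length t) + m) = of_bool (reached t a b m))"

definition dp_mid :: "event list \<Rightarrow> nat \<Rightarrow> nat \<Rightarrow> nat \<Rightarrow> (nat \<times> nat) list \<Rightarrow> nat \<Rightarrow> bool \<Rightarrow> state \<Rightarrow> bool"
  where "dp_mid t a b g O' k c s \<longleftrightarrow> dp_inv t a b g O' k s \<and>
     reg s R_i = k div length t \<and> reg s R_j = k mod length t \<and> reg s R_c = of_bool c"

lemma reach_iff:
  "reach t a b i j \<longleftrightarrow> i = 0 \<and> j = 0 \<or>
     (\<exists>i'. i = Suc i' \<and> i' < length t \<and> reach t a b i' j \<and> enabled t a b 0 i' j) \<or>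
     (\<exists>j'. j = Suc j' \<and> j' < length t \<and> reach t a b i j' \<and> enabled t a b 1 i j')"
  by (subst reach.simps) blast

text \<open>In row numbering a step of process 0 adds \<open>length t\<close> and a step of process
  1 adds 1. The positivity conditions guarantee that the subtractions invert these steps.\<close>

lemma reached_iff:
  assumes m: "m < length t * length t"
  shows "reached t a b m \<longleftrightarrow> m = 0 \<or>
    0 < m div length t \<and> reached t a b (m - length t) \<and>
      enabled t a b 0 ((m - length t) div length t) ((m - length t) mod length t) \<or>
    0 < m mod length t \<and> reached t a b (m - 1) \<and>
      enabled t a b 1 ((m - 1) div length t) ((m - 1) mod length t)"
proof -
  define n where "n = length t"
  define i j where "i = m div n" and "j = m mod n"
  have n: "0 < n" using m by (cases n) (auto simp: n_def)
  have mij: "m = i * n + j" "j < n" using n by (simp_all add: i_def j_def)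
  have i: "i < n" using m less_mult_imp_div_less[of m n n] by (simp add: i_def n_def)
  have up: "(m - n) div n = i'" "(m - n) mod n = j" if "i = Suc i'" for i'
    using mij that by simp_all
  have left: "(m - 1) div n = i" "(m - 1) mod n = j'" if "j = Suc j'" for j'
    using mij that by simp_all
  have "m = 0 \<longleftrightarrow> i = 0 \<and> j = 0" using mij n by auto
  moreover have "(\<exists>i'. i = Suc i' \<and> i' < n \<and> reach t a b i' j \<and> enabled t a b 0 i' j) \<longleftrightarrow>
    0 < i \<and> reach t a b ((m - n) div n) ((m - n) mod n) \<and>
      enabled t a b 0 ((m - n) div n) ((m - n) mod n)"
    using up i by (cases i) auto
  moreover have "(\<exists>j'. j = Suc j' \<and> j' < n \<and> reach t a b i j' \<and> enabled t a b 1 i j') \<longleftrightarrow>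
    0 < j \<and> reach t a b ((m - 1) div n) ((m - 1) mod n) \<and>
      enabled t a b 1 ((m - 1) div n) ((m - 1) mod n)"
    using left mij(2) by (cases j) auto
  ultimately show ?thesis
    unfolding reached_def n_def[symmetric] i_def[symmetric] j_def[symmetric]
    by (subst reach_iff[of t a b i j, folded n_def]) blast
qed

lemma wp_follow:
  assumes I: "dp_mid t a b g O' k c s" and x: "reg s R_x = m" "m < k" and k: "k < length t * length t"
    and ab: "a < length t" "b < length t"
    and W: "5 * (length t * length t) + 3 * length t + 20 \<le> W"
    and q: "q = 0 \<and> shift = Skip \<or> q = 1 \<and> shift = Arith Plus R_x R_x R_two"
  shows "wp W (follow shift) (dp_mid t a b g O' k (c \<or> reached t a b m \<and>
    enabled t a b q (m div length t) (m mod length t))) s"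
proof -
  define N where "N = length t * length t"
  define B where "B = 4 + 3 * length t"
  have cr: "const_regs (length t) (reg s)" and
    st: "reg s R_a = a" "reg s R_b = b" "reg s R_c = of_bool c"
    using I by (simp_all add: dp_mid_def dp_inv_def)
  have rm: "mem s (B + 4 * N + m) = of_bool (reached t a b m)"
    using I x by (simp add: dp_mid_def dp_inv_def B_def N_def)
  \<comment> \<open>Step \<open>q\<close> from pair \<open>m\<close> has number
    \<open>2 * m + q\<close> in the table, and each step occupies two cells.\<close>
  have T: "\<forall>a b. a < mem s (B + 2 * (2 * m + q)) \<and> b < mem s (B + (2 * (2 * m + q) + 1)) \<longleftrightarrow>
     a < length t \<and> b < length t \<and> enabled t a b q (m div length t) (m mod length t)"
  proof -
    have "2 * m + q < 2 * N" using q x k by (auto simp: N_def)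
    moreover have "(2 * m + q) mod 2 = q" "(2 * m + q) div 2 = m" using q by auto
    ultimately show ?thesis using I unfolding dp_mid_def dp_inv_def table_def B_def N_def by metis
  qed
  then have en: "a < mem s (B + 2 * (2 * m + q)) \<and> b < mem s (Suc (B + 2 * (2 * m + q))) \<longleftrightarrow>
     enabled t a b q (m div length t) (m mod length t)"
    using ab by simp
  have regs: "reg s R_zero = 0" "reg s R_one = 1" "reg s R_two = 2" "reg s R_four = 4"
    "reg s R_base = B" "reg s R_rbase = B + 4 * N"
    using const_regsD[OF cr] by (simp_all add: B_def N_def)
  have W': "B + 4 * N + m < W" "B + 4 * m + 3 < W" using W x k by (simp_all add: B_def N_def)
  \<comment> \<open>Only these five work registers are changed, and of them \<open>dp_mid\<close>
    mentions \<open>R_c\<close> alone.\<close>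
  have I': "dp_mid t a b g O' k c' (s\<lparr>reg := R\<rparr>)"
    if "\<forall>r. r \<notin> {R_f, R_x, R_A, R_B, R_c} \<longrightarrow> R r = reg s r" "R R_c = of_bool c'" for R c'
    using I that unfolding dp_mid_def dp_inv_def const_regs_def by simp
  show ?thesis
  proof (cases "reached t a b m")
    case False
    then show ?thesis
      unfolding follow_def using W' x st rm I' by (simp add: regs)
  next
    case True
    from q show ?thesis
    proof
      assume q: "q = 0 \<and> shift = Skip"
      show ?thesis
        unfolding follow_def using q True en W' x st rm
        by (simp add: regs) (auto intro!: I' simp: st split: if_splits)
    next
      assume q: "q = 1 \<and> shift = Arith Plus R_x R_x R_two"
      show ?thesis
        unfolding follow_def using q True en W' x st rm
        by (simp add: regs) (auto intro!: I' simp: st split: if_splits)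
    qed
  qed
qed

lemma wp_Skip [simp]: "wp W Skip Q = Q"
  by (rule ext) simp

lemma wp_reach_step:
  assumes I: "dp_inv t a b g O' k s" and k: "k < length t * length t"
    and ab: "a < length t" "b < length t"
    and W: "5 * (length t * length t) + 3 * length t + 20 \<le> W"
  shows "wp W reach_step (dp_inv t a b g O' (Suc k)) s"
proof -
  define n where "n = length t"
  let ?mid = "dp_mid t a b g O' k"
  define up where "up \<longleftrightarrow> 0 < k div n \<and> reached t a b (k - n) \<and>
      enabled t a b 0 ((k - n) div n) ((k - n) mod n)"
  define lt where "lt \<longleftrightarrow> 0 < k mod n \<and> reached t a b (k - 1) \<and>
      enabled t a b 1 ((k - 1) div n) ((k - 1) mod n)"
  have reached: "reached t a b k \<longleftrightarrow> (k = 0 \<or> up) \<or> lt"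
    unfolding up_def lt_def n_def using reached_iff[OF k, of a b] by blast
  have n: "0 < n" using ab unfolding n_def by linarith
  have kW: "k < W" "0 < W" "1 < W" "k div n < W" "k mod n < W" "k - n < W" "k - 1 < W"
    using k W div_le_dividend[of k n] mod_less_eq_dividend[of k n] by linarith+
  have set_x: "?mid c (s\<lparr>reg := (reg s)(R_x := v)\<rparr>)" if "?mid c s" for c s v
    using that by (simp add: dp_mid_def dp_inv_def)
  have cr: "const_regs n (reg s)" "reg s R_m = k" if "?mid c s" for c s
    using that by (simp_all add: dp_mid_def dp_inv_def n_def)
  have split: "reach_step = seq ([Arith Div R_i R_m R_n, Arith Mod R_j R_m R_n, Const R_c 0,
     IfLess R_m R_one (Const R_c 1) Skip] @
     [IfLess R_zero R_i (seq [Arith Minus R_x R_m R_n, follow Skip]) Skip] @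
     [IfLess R_zero R_j (seq [Arith Minus R_x R_m R_one, follow (Arith Plus R_x R_x R_two)]) Skip] @
     [Arith Plus R_x R_rbase R_m, Store R_x R_c, incr R_m])"
    (is "_ = seq (?c1 @ ?c2 @ ?c3 @ ?c4)")
    by (simp add: reach_step_def)
  have c1: "wp W (seq ?c1) (?mid (k = 0)) s"
  proof -
    have "const_regs n (reg s)" "reg s R_m = k" using I by (simp_all add: dp_inv_def n_def)
    note r = const_regsD[OF this(1)] this(2)
    show ?thesis using I kW by (simp add: r dp_mid_def dp_inv_def flip: n_def)
  qed
  have c2: "wp W (seq ?c2) (?mid (k = 0 \<or> up)) s" if "?mid (k = 0) s" for s
  proof (cases "0 < k div n")
    case True
    then have "k - n < k" using n by (simp add: div_greater_zero_iff)
    have "wp W (follow Skip) (?mid (k = 0 \<or> reached t a b (k - n) \<and>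
        enabled t a b 0 ((k - n) div n) ((k - n) mod n))) (s\<lparr>reg := (reg s)(R_x := k - n)\<rparr>)"
      unfolding n_def
      by (rule wp_follow[OF set_x[OF that] _ _ k ab W]) (use \<open>k - n < k\<close> in \<open>auto simp: n_def\<close>)
    moreover have "reg s R_i = k div n" using that by (simp add: dp_mid_def n_def)
    ultimately show ?thesis
      using True cr[OF that] const_regsD[OF cr(1)[OF that]] kW by (simp add: up_def)
  next
    case False
    moreover have "reg s R_i = k div n" using that by (simp add: dp_mid_def n_def)
    ultimately show ?thesis
      using that const_regsD[OF cr(1)[OF that]] by (simp add: up_def)
  qed
  have c3: "wp W (seq ?c3) (?mid (reached t a b k)) s" if "?mid (k = 0 \<or> up) s" for s
  proof (cases "0 < k mod n")
    case True
    then have "0 < k" by (cases k) auto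
    have "wp W (follow (Arith Plus R_x R_x R_two)) (?mid ((k = 0 \<or> up) \<or> reached t a b (k - 1) \<and>
        enabled t a b 1 ((k - 1) div n) ((k - 1) mod n))) (s\<lparr>reg := (reg s)(R_x := k - 1)\<rparr>)"
      unfolding n_def
      by (rule wp_follow[OF set_x[OF that] _ _ k ab W]) (use \<open>0 < k\<close> in auto)
    moreover have "reg s R_j = k mod n" using that by (simp add: dp_mid_def n_def)
    ultimately show ?thesis unfolding reached
      using True cr[OF that] const_regsD[OF cr(1)[OF that]] kW by (simp add: lt_def)
  next
    case False
    moreover have "reg s R_j = k mod n" using that by (simp add: dp_mid_def n_def)
    ultimately show ?thesis unfolding reached
      using that const_regsD[OF cr(1)[OF that]] by (simp add: lt_def)
  qed
  have c4: "wp W (seq ?c4) (dp_inv t a b g O' (Suc k)) s" if mid: "?mid (reached t a b k) s" for s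
  proof -
    note r = const_regsD[OF cr(1)[OF mid]] cr(2)[OF mid]
    have "4 + 3 * n + 4 * (n * n) + k < W" "Suc k < W" using W k by (simp_all add: n_def)
    then show ?thesis
      using mid by (simp add: r dp_mid_def dp_inv_def table_upd less_Suc_eq flip: n_def)
  qed
  show ?thesis
    unfolding split wp_seq_append
    by (rule wp_mono[OF c1], rule wp_mono[OF c2], assumption, rule wp_mono[OF c3], assumption, rule c4)
qed

text \<open>This is what persists from one target to the next; the reachability flags belong to a
  single target and are left out.\<close>

definition base_inv :: "event list \<Rightarrow> nat \<Rightarrow> state \<Rightarrow> bool" where
  "base_inv t g s \<longleftrightarrow> const_regs (length t) (reg s) \<and> input_at t (mem s) \<and>
     table t (2 * (length t * length t)) (mem s) \<and> reg s R_target = g"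

lemma run_search_target:
  assumes I: "base_inv t g s" "reg s R_a = a" "reg s R_b = b" "out s = O'"
    and ab: "a < length t" "b < length t" and g: "g < length t * length t"
    and W: "5 * (length t * length t) + 3 * length t + 20 \<le> W"
  shows "run W (Suc (length t * length t) * 200) search_target
    (\<lambda>s. base_inv t g s \<and> out s = O' @ (if reached t a b g then [(a, b)] else [])) s"
    (is "run _ _ _ ?Q _")
proof -
  let ?n = "length t"
  have "run W (cost (Const R_m 0) + (Suc (?n * ?n - 0) * Suc (cost reach_step) + cost report_target))
    search_target ?Q s"
    unfolding search_target_def
  proof (rule run_Seq, rule run_mono[OF run_wp order_refl])
    show "wp W (Const R_m 0) (dp_inv t a b g O' 0) s"
      using I W by (simp add: dp_inv_def base_inv_def)
  next
    fix s assume "dp_inv t a b g O' 0 s"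
    then have "run W (Suc (?n * ?n - 0) * Suc (cost reach_step)) (WhileLess R_m R_nn reach_step)
      (dp_inv t a b g O' (?n * ?n)) s"
    proof (rule run_while)
      show "reg s R_m = k \<and> reg s R_nn = ?n * ?n" if "dp_inv t a b g O' k s" for k s
        using that const_regsD[of ?n "reg s"] by (simp add: dp_inv_def)
    next
      fix k s assume k: "k < ?n * ?n" and "dp_inv t a b g O' k s"
      then show "run W (cost reach_step) reach_step (dp_inv t a b g O' (Suc k)) s"
        by (intro run_wp wp_reach_step ab W)
    qed simp
    then show "run W (Suc (?n * ?n - 0) * Suc (cost reach_step) + cost report_target)
      (Seq (WhileLess R_m R_nn reach_step) report_target) ?Q s"
    proof (intro run_Seq, elim run_mono[OF _ order_refl])
      fix s assume I: "dp_inv t a b g O' (?n * ?n) s"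
      then have "const_regs ?n (reg s)" by (simp add: dp_inv_def)
      note r = const_regsD[OF this]
      have "4 + 3 * ?n + 4 * (?n * ?n) + g < W" using W g by simp
      then have "wp W report_target ?Q s"
        using I g by (simp add: report_target_def r dp_inv_def base_inv_def)
      then show "run W (cost report_target) report_target ?Q s" by (rule run_wp)
    qed
  qed
  moreover have "cost (Const R_m 0) + (Suc (?n * ?n - 0) * Suc (cost reach_step) + cost report_target)
    \<le> Suc (?n * ?n) * 200"
    by (simp add: reach_step_def report_target_def follow_def)
  ultimately show ?thesis by (rule run_mono)
qed

section \<open>Enumeration of the targets\<close>

definition candidate :: "event list \<Rightarrow> nat \<Rightarrow> nat \<Rightarrow> bool" where
  "candidate t a b \<longleftrightarrow> proc (t ! a) = 0 \<and> proc (t ! b) \<noteq> 0 \<and>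
     num (t ! a) = num (t ! b) \<and> ty (t ! a) + ty (t ! b) < 2"

definition hits :: "event list \<Rightarrow> nat \<Rightarrow> (nat \<times> nat) set" where
  "hits t g = (\<lambda>g'. (g' div length t, g' mod length t)) `
     {g'. g' < g \<and> candidate t (g' div length t) (g' mod length t) \<and>
       reached t (g' div length t) (g' mod length t) g'}"

lemma hits_0 [simp]: "hits t 0 = {}"
  by (simp add: hits_def)

lemma hits_Suc:
  "hits t (Suc g) = hits t g \<union>
    (if candidate t (g div length t) (g mod length t) \<and>
        reached t (g div length t) (g mod length t) g
     then {(g div length t, g mod length t)} else {})"
  unfolding hits_def by (auto simp: less_Suc_eq)

definition target_inv :: "event list \<Rightarrow> nat \<Rightarrow> (nat \<times> nat) list \<Rightarrow> state \<Rightarrow> bool" where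
  "target_inv t g O' s \<longleftrightarrow> base_inv t g s \<and> out s = O' \<and>
     (let a = g div length t; b = g mod length t in
      reg s R_a = a \<and> reg s R_b = b \<and> reg s R_pp = proc (t ! a) \<and> reg s R_rp = proc (t ! b) \<and>
      reg s R_pv = num (t ! a) \<and> reg s R_rv = num (t ! b) \<and> reg s R_x = ty (t ! a) + ty (t ! b))"

lemma ty_le: "ty e \<le> 3"
  by (cases "action e") (simp_all add: ty_def)

lemma wp_fetch_target:
  assumes I: "base_inv t g s" "out s = O'" and g: "g < length t * length t"
    and W: "5 * (length t * length t) + 3 * length t + 20 \<le> W"
  shows "wp W fetch_target (target_inv t g O') s"
proof -
  define n where "n = length t"
  define a b where "a = g div n" and "b = g mod n"
  have n: "0 < n" using g by (cases n) (auto simp: n_def)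
  have ab: "a < n" "b < n"
    using less_mult_imp_div_less[of g n n] g n by (simp_all add: a_def b_def n_def)
  have W': "a < W" "b < W" "3 * n + 20 \<le> W" "ty (t ! a) + ty (t ! b) < W"
    using ab W ty_le[of "t ! a"] ty_le[of "t ! b"] by (simp_all add: n_def)
  define P where "P \<equiv> \<lambda>s :: state. base_inv t g s \<and> out s = O' \<and> reg s R_a = a \<and> reg s R_b = b"
  define P' where "P' \<equiv> \<lambda>s :: state. P s \<and> reg s R_pp = proc (t ! a) \<and> reg s R_pt = ty (t ! a) \<and>
    reg s R_pv = num (t ! a)"
  have cr: "const_regs n (reg s)" "input_at t (mem s)" if "P s" for s
    using that by (simp_all add: P_def base_inv_def n_def)
  have split: "fetch_target = seq ([Arith Div R_a R_target R_n, Arith Mod R_b R_target R_n] @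
     (fetch R_a R_pp R_pt R_pv # fetch R_b R_rp R_rt R_rv # [Arith Plus R_x R_pt R_rt]))"
    by (simp add: fetch_target_def)
  have c1: "wp W (seq [Arith Div R_a R_target R_n, Arith Mod R_b R_target R_n]) P s"
  proof -
    have c: "const_regs n (reg s)" "reg s R_target = g" using I by (simp_all add: base_inv_def n_def)
    note r = const_regsD[OF c(1)] c(2)
    show ?thesis
      using I W' by (simp add: r P_def base_inv_def flip: a_def b_def n_def)
  qed
  have c2: "wp W (seq (fetch R_a R_pp R_pt R_pv # fetch R_b R_rp R_rt R_rv # [Arith Plus R_x R_pt R_rt]))
    (target_inv t g O') s" if P: "P s" for s
  proof (rule wp_seq_Cons)
    show "wp W (fetch R_a R_pp R_pt R_pv) P' s"
      by (rule wp_fetch[OF cr[OF P] n_def]) (use P ab W' in \<open>simp_all add: P_def P'_def base_inv_def\<close>)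
  next
    fix s assume P': "P' s"
    then have P: "P s" by (simp add: P'_def)
    show "wp W (seq (fetch R_b R_rp R_rt R_rv # [Arith Plus R_x R_pt R_rt])) (target_inv t g O') s"
    proof (rule wp_seq_Cons)
      show "wp W (fetch R_b R_rp R_rt R_rv) (\<lambda>s. P' s \<and> reg s R_rp = proc (t ! b) \<and>
          reg s R_rt = ty (t ! b) \<and> reg s R_rv = num (t ! b)) s"
        by (rule wp_fetch[OF cr[OF P] n_def]) (use P' ab W' in \<open>simp_all add: P_def P'_def base_inv_def\<close>)
    next
      fix s assume "P' s \<and> reg s R_rp = proc (t ! b) \<and>
          reg s R_rt = ty (t ! b) \<and> reg s R_rv = num (t ! b)"
      then show "wp W (seq [Arith Plus R_x R_pt R_rt]) (target_inv t g O') s"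
        using W' by (simp add: P_def P'_def target_inv_def base_inv_def Let_def flip: n_def a_def b_def)
    qed
  qed
  show ?thesis unfolding split wp_seq_append by (rule wp_mono[OF c1 c2])
qed

definition search_inv :: "event list \<Rightarrow> nat \<Rightarrow> state \<Rightarrow> bool" where
  "search_inv t g s \<longleftrightarrow> base_inv t g s \<and> set (out s) = hits t g"

lemma run_search:
  assumes s: "const_regs (length t) (reg s)" "input_at t (mem s)"
      "table t (2 * (length t * length t)) (mem s)" "out s = []"
    and W: "5 * (length t * length t) + 3 * length t + 20 \<le> W"
  shows "run W (Suc (length t * length t) * (Suc (length t * length t) * 300)) search
    (\<lambda>s. set (out s) = hits t (length t * length t)) s"
proof -
  let ?n = "length t"
  let ?c = "Suc (?n * ?n) * 200"
  let ?test = "IfLess R_pp R_one (IfLess R_zero R_rp (if_eq R_pv R_rv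
        (IfLess R_x R_two search_target Skip) Skip) Skip) Skip"
  \<comment> \<open>This mirrors the nesting of \<open>?test\<close> as charged by
    \<open>run_If\<close>: each comparison adds one to the sum of its branches, a
    \<open>Skip\<close> counts 1, the search counts \<open>?c\<close>, and the equality test
    consists of two comparisons.\<close>
  let ?t = "Suc (Suc (Suc (1 + Suc (1 + Suc (?c + 1))) + 1) + 1)"
  let ?b = "cost fetch_target + (?t + cost (incr R_target))"
  have "run W (cost (Const R_target 0) + Suc (?n * ?n - 0) * Suc ?b) search (search_inv t (?n * ?n)) s"
    unfolding search_def
  proof (rule run_Seq, rule run_mono[OF run_wp order_refl])
    show "wp W (Const R_target 0) (search_inv t 0) s"
      using s W by (simp add: search_inv_def base_inv_def)
  next
    fix s assume "search_inv t 0 s"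
    then show "run W (Suc (?n * ?n - 0) * Suc ?b)
      (WhileLess R_target R_nn (Seq fetch_target (Seq ?test (incr R_target)))) (search_inv t (?n * ?n)) s"
    proof (rule run_while)
      show "reg s R_target = k \<and> reg s R_nn = ?n * ?n" if "search_inv t k s" for k s
        using that const_regsD[of ?n "reg s"] by (simp add: search_inv_def base_inv_def)
    next
      fix g s assume g: "g < ?n * ?n" and I: "search_inv t g s"
      define a b where "a = g div ?n" and "b = g mod ?n"
      have n: "0 < ?n" using g by (cases ?n) auto
      have ab: "a < ?n" "b < ?n"
        using less_mult_imp_div_less[of g ?n ?n] g n by (simp_all add: a_def b_def)
      define O' where "O' = out s"
      let ?Q = "\<lambda>s. base_inv t g s \<and> set (out s) = hits t (Suc g)"
      have O: "set O' = hits t g" using I by (simp add: search_inv_def O'_def)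
      show "run W ?b (Seq fetch_target (Seq ?test (incr R_target))) (search_inv t (Suc g)) s"
      proof (rule run_Seq, rule run_mono[OF run_wp[OF wp_fetch_target[OF _ O'_def[symmetric] g W]] order_refl])
        show "base_inv t g s" using I by (simp add: search_inv_def)
      next
        fix s assume T: "target_inv t g O' s"
        then have B: "base_inv t g s" and out: "out s = O'" by (simp_all add: target_inv_def)
        have R: "reg s R_a = a" "reg s R_b = b" "reg s R_pp = proc (t ! a)" "reg s R_rp = proc (t ! b)"
          "reg s R_pv = num (t ! a)" "reg s R_rv = num (t ! b)" "reg s R_x = ty (t ! a) + ty (t ! b)"
          using T by (simp_all add: target_inv_def Let_def a_def b_def)
        have "const_regs ?n (reg s)" using B by (simp add: base_inv_def)
        note r = const_regsD[OF this]
        have skip: "run W 1 Skip ?Q s" if "\<not> candidate t a b"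
          using run_wp[of W Skip ?Q s] that B out O
          by (simp add: hits_Suc flip: a_def b_def)
        have report: "run W ?c search_target ?Q s" if "candidate t a b"
          by (rule run_mono[OF run_search_target[OF B R(1,2) out ab g W] order_refl])
             (use that O in \<open>auto simp: hits_Suc simp flip: a_def b_def\<close>)
        have "run W ?t ?test ?Q s"
          unfolding if_eq_def
          by (intro run_If; (rule skip | rule report); use R r in \<open>simp add: candidate_def\<close>)
        then show "run W (?t + cost (incr R_target)) (Seq ?test (incr R_target)) (search_inv t (Suc g)) s"
        proof (intro run_Seq, elim run_mono[OF _ order_refl])
          fix s assume *: "?Q s"
          then have "const_regs ?n (reg s)" "reg s R_target = g" by (simp_all add: base_inv_def)
          note r = const_regsD[OF this(1)] this(2)
          have "Suc g < W" using g W by simp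
          then have "wp W (incr R_target) (search_inv t (Suc g)) s"
            using * by (simp add: r search_inv_def base_inv_def)
          then show "run W (cost (incr R_target)) (incr R_target) (search_inv t (Suc g)) s" by (rule run_wp)
        qed
      qed
    qed simp
  qed
  moreover have "cost (Const R_target 0) + Suc (?n * ?n - 0) * Suc ?b \<le>
    Suc (?n * ?n) * (Suc (?n * ?n) * 300)"
  proof -
    have "Suc (Suc ?b) \<le> Suc (?n * ?n) * 300"
      by (simp add: fetch_target_def fetch_def)
    then have "Suc (?n * ?n) * Suc (Suc ?b) \<le> Suc (?n * ?n) * (Suc (?n * ?n) * 300)"
      by (rule mult_le_mono2)
    moreover have "1 + Suc x * y \<le> Suc x * Suc y" for x y :: nat by simp
    ultimately show ?thesis unfolding cost.simps diff_zero by (rule le_trans[rotated])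
  qed
  ultimately show ?thesis by (rule run_mono) (simp add: search_inv_def)
qed

section \<open>Initial state and running time\<close>

lemma nth_concat_triples:
  "p < length t \<Longrightarrow> q < 3 \<Longrightarrow> (\<And>e. length (f e) = 3) \<Longrightarrow> concat (map f t) ! (3 * p + q) = f (t ! p) ! q"
proof (induction t arbitrary: p)
  case (Cons e t)
  then show ?case by (cases p) (simp_all add: nth_append)
qed simp

abbreviation encode_event :: "event \<Rightarrow> nat list" where
  "encode_event e \<equiv> proc e # encode_action (action e)"

lemma encode_event: "encode_event e = [proc e, ty e, num e]"
  by (cases "action e") (simp_all add: ty_def num_def)

lemma length_concat_triples: "(\<And>e. length (f e) = 3) \<Longrightarrow> length (concat (map f t)) = 3 * length t"
  by (induction t) auto

lemma initial_mem:
  shows "mem (initial_state k V L t) 0 = k" "mem (initial_state k V L t) 3 = length t"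
    and "input_at t (mem (initial_state k V L t))"
proof -
  let ?c = "concat (map encode_event t)"
  have l: "length ?c = 3 * length t" by (rule length_concat_triples) (simp add: encode_event)
  show "mem (initial_state k V L t) 0 = k" "mem (initial_state k V L t) 3 = length t"
    by (simp_all add: initial_state_def encode_input_def Let_def nth_append)
  have n: "?c ! (3 * p + q) = encode_event (t ! p) ! q" if "p < length t" "q < 3" for p q
    by (rule nth_concat_triples) (use that in \<open>simp_all add: encode_event\<close>)
  have "mem (initial_state k V L t) (4 + (3 * p + q)) = [proc (t ! p), ty (t ! p), num (t ! p)] ! q"
    if "p < length t" "q < 3" for p q
    using n[OF that] l that
    by (simp add: initial_state_def encode_input_def Let_def nth_append encode_event)
  from this[of _ 0] this[of _ 1] this[of _ 2] show "input_at t (mem (initial_state k V L t))"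
    by (simp add: input_at_def add.assoc[symmetric] add.commute[of _ "3 * _"])
qed

text \<open>Writes have type 0, reads 1 and lock events at least 2. A sum below 2 thus means two
  accesses to variables that are not both reads, and then equal numbers are equal locations.\<close>

lemma conflicting_iff:
  "e1 \<noteq> e2 \<Longrightarrow> conflicting e1 e2 \<longleftrightarrow> num e1 = num e2 \<and> ty e1 + ty e2 < 2"
  by (cases "action e1"; cases "action e2") (auto simp: conflicting_def ty_def num_def)

text \<open>The left side of the first bound exceeds every address used: \<open>4 + 3 n\<close>
  input cells, \<open>4 n^2\<close> table cells and \<open>n^2\<close> flags. As
  \<open>2 <= k\<close>, the base of the power is at least \<open>n + 4\<close>, and a cube is
  enough for all \<open>n\<close>.\<close>

lemma word_bound_ge:
  assumes "2 \<le> k"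
  shows "5 * (length t * length t) + 3 * length t + 20 \<le> word_bound 3 k V L t"
    and "length t + k + V + L + 2 \<le> word_bound 3 k V L t"
proof -
  let ?n = "length t" and ?B = "length t + k + V + L + 2"
  have "(?n + 4) ^ 3 \<le> ?B ^ 3" using assms by (intro power_mono) simp_all
  moreover have "5 * (?n * ?n) + 3 * ?n + 20 \<le> (?n + 4) ^ 3"
    by (simp add: power3_eq_cube algebra_simps)
  ultimately show "5 * (?n * ?n) + 3 * ?n + 20 \<le> word_bound 3 k V L t"
    unfolding word_bound_def by linarith
  show "?B \<le> word_bound 3 k V L t"
    unfolding word_bound_def by (rule self_le_power) simp_all
qed

lemma bounded_initial:
  assumes k: "2 \<le> k" and t: "input_trace k V L t"
  shows "bounded (word_bound 3 k V L t) (initial_state k V L t)"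
proof -
  let ?W = "word_bound 3 k V L t"
  note W = word_bound_ge[OF k, of t V L]
  have e: "x < ?W" if "e \<in> set t" "x \<in> set (encode_event e)" for e x
  proof -
    have "proc e < k" "loc e \<in> Var ` {..<V} \<union> Lock ` {..<L}"
      using t that(1) by (auto simp: input_trace_def)
    moreover from this(2) have "num e < V + L"
      by (cases "action e") (auto simp: num_def)
    ultimately show ?thesis
      using that(2) W(2) ty_le[of e] k by (auto simp: encode_event)
  qed
  have "x < ?W" if "x \<in> set (encode_input k V L t)" for x
    using that e W(2) k by (auto simp: encode_input_def)
  then show ?thesis
    using W(2) unfolding bounded_def initial_state_def Let_def by auto
qed

lemma run_race_program:
  fixes k V L :: nat
  assumes k: "2 \<le> k" and t: "is_trace t"
  defines "W \<equiv> word_bound 3 k V L t"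
  shows "run W (1000 * Suc (length t) ^ 4) race_program
    (\<lambda>s. if k = 2 then set (out s) = hits t (length t * length t) else out s = [])
    (initial_state k V L t)"
proof -
  let ?n = "length t"
  let ?Q = "\<lambda>s. if k = 2 then set (out s) = hits t (?n * ?n) else out s = []"
  let ?s = "initial_state k V L t"
  let ?b1 = "Suc (2 * (?n * ?n)) * (Suc ?n * 200)"
  let ?b2 = "Suc (?n * ?n) * (Suc (?n * ?n) * 300)"
  let ?P = "\<lambda>s :: state. reg s = (reg ?s)(R_three := 3, R_n := k) \<and> mem s = mem ?s \<and> out s = []"
  have W: "5 * (?n * ?n) + 3 * ?n + 20 \<le> W" "k < W"
    using word_bound_ge[OF k, of t V L] by (simp_all add: W_def)
  have init: "reg ?s = (\<lambda>_. 0)" "out ?s = []" by (simp_all add: initial_state_def Let_def)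
  have "run W (cost (seq [Const R_three 3, Load R_n R_zero]) +
      Suc ((cost init_regs + (?b1 + ?b2)) + 1)) race_program ?Q ?s"
    unfolding race_program_def
  proof (rule run_Seq, rule run_mono[OF run_wp order_refl])
    show "wp W (seq [Const R_three 3, Load R_n R_zero]) ?P ?s"
      using W initial_mem(1)[of k V L t] init by (simp add: fun_upd_def)
  next
    fix s assume P: "?P s"
    show "run W (Suc ((cost init_regs + (?b1 + ?b2)) + 1))
      (IfLess R_n R_three (Seq init_regs (Seq tabulate search)) Skip) ?Q s"
    proof (rule run_If)
      assume "reg s R_n < reg s R_three"
      then have k2: "k = 2" using P k by simp
      let ?R = "\<lambda>s :: state. const_regs ?n (reg s) \<and> input_at t (mem s) \<and> out s = []"
      have "wp W init_regs ?R s"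
        using P W init initial_mem(1,2)[of k V L t] initial_mem(3)[of t k V L]
        by (simp add: init_regs_def const_regs_def)
      then have "run W (cost init_regs) init_regs ?R s" by (rule run_wp)
      then show "run W (cost init_regs + (?b1 + ?b2)) (Seq init_regs (Seq tabulate search)) ?Q s"
      proof (intro run_Seq, elim run_mono[OF _ order_refl])
        fix s assume "?R s"
        then have "run W ?b1 tabulate (tab_inv t (2 * (?n * ?n))) s"
          using run_tabulate[OF t W(1)] by blast
        then show "run W (?b1 + ?b2) (Seq tabulate search) ?Q s"
        proof (intro run_Seq, elim run_mono[OF _ order_refl])
          fix s assume "tab_inv t (2 * (?n * ?n)) s"
          then have "run W ?b2 search (\<lambda>s. set (out s) = hits t (?n * ?n)) s"
            using run_search[OF _ _ _ _ W(1)] by (simp add: tab_inv_def)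
          then show "run W ?b2 search ?Q s" using k2 by simp
        qed
      qed
    next
      assume "\<not> reg s R_n < reg s R_three"
      then show "run W 1 Skip ?Q s"
        using run_wp[of W Skip ?Q s] P by simp
    qed
  qed
  moreover have "cost (seq [Const R_three 3, Load R_n R_zero]) +
      Suc ((cost init_regs + (?b1 + ?b2)) + 1) \<le> 1000 * Suc ?n ^ 4"
  proof -
    \<comment> \<open>The table costs only order \<open>N^3\<close> and is rounded up; the search
      gives the true order \<open>N^4\<close>. The three parts sum to at most
      \<open>400 + 300 + 100\<close> times \<open>N^4\<close>.\<close>
    define N where "N = Suc ?n"
    have 1: "Suc (2 * (?n * ?n)) \<le> 2 * (N * N)" and 2: "Suc (?n * ?n) \<le> N * N"
      by (simp_all add: N_def)
    have N1: "1 \<le> N" by (simp add: N_def)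
    have "?b1 \<le> 2 * (N * N) * (N * 200)"
      using 1 by (intro mult_le_mono) (simp_all add: N_def)
    also have "\<dots> = 400 * (N * N * N) * 1" by simp
    also have "\<dots> \<le> 400 * (N * N * N) * N" using N1 by (intro mult_le_mono2)
    finally have b1: "?b1 \<le> 400 * N ^ 4" by (simp add: power4_eq_xxxx)
    have "?b2 \<le> (N * N) * ((N * N) * 300)"
      using 2 by (intro mult_le_mono) simp_all
    then have b2: "?b2 \<le> 300 * N ^ 4" by (simp add: power4_eq_xxxx)
    have "1 \<le> N ^ 4" using N1 by (simp add: one_le_power)
    moreover have "cost (seq [Const R_three 3, Load R_n R_zero]) + Suc (cost init_regs + 1) \<le> 100"
      by (simp add: init_regs_def)
    ultimately have "cost (seq [Const R_three 3, Load R_n R_zero]) +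
      Suc ((cost init_regs + (?b1 + ?b2)) + 1) \<le> 1000 * N ^ 4"
      using b1 b2 by linarith
    then show ?thesis by (simp only: N_def)
  qed
  ultimately show ?thesis by (rule run_mono)
qed

text \<open>The loop counter enumerates all pairs of positions by quotient and remainder. Pairs in
  which both events belong to process 0 satisfy neither side.\<close>

lemma hits_iff:
  assumes tr: "is_trace t" and p: "\<And>e. e \<in> set t \<Longrightarrow> proc e < 2"
  shows "(a, b) \<in> hits t (length t * length t) \<longleftrightarrow>
    a < length t \<and> b < length t \<and> proc (t ! a) = 0 \<and> predictable_race t (t ! a) (t ! b)"
proof -
  let ?n = "length t"
  have race: "predictable_race t (t ! a) (t ! b) \<longleftrightarrow>
      candidate t a b \<and> reach t a b a b" if "a < ?n" "b < ?n" "proc (t ! a) = 0" for a b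
  proof (cases "proc (t ! b) = 0")
    case True
    then show ?thesis using that by (simp add: predictable_race_def candidate_def)
  next
    case False
    then have b: "proc (t ! b) = 1" using p[of "t ! b"] that by simp
    then have "t ! a \<noteq> t ! b" using that by auto
    then show ?thesis
      using predictable_race_iff_reach[OF tr p that(1,2,3) b] conflicting_iff[of "t ! a" "t ! b"] that b
      by (simp add: candidate_def)
  qed
  have idx: "a < ?n \<and> b < ?n \<longleftrightarrow> (\<exists>g < ?n * ?n. g div ?n = a \<and> g mod ?n = b)" for a b
  proof
    assume ab: "a < ?n \<and> b < ?n"
    then have "a * ?n + b < Suc a * ?n" by simp
    also have "\<dots> \<le> ?n * ?n" using ab by (intro mult_le_mono1) simp
    finally have "a * ?n + b < ?n * ?n" .
    moreover have "(a * ?n + b) div ?n = a" "(a * ?n + b) mod ?n = b"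
      using ab by auto (subst div_mult_self3; auto)
    ultimately show "\<exists>g < ?n * ?n. g div ?n = a \<and> g mod ?n = b" by blast
  next
    assume "\<exists>g < ?n * ?n. g div ?n = a \<and> g mod ?n = b"
    then obtain g where g: "g < ?n * ?n" "g div ?n = a" "g mod ?n = b" by blast
    moreover have "0 < ?n" using g(1) by (cases ?n) auto
    ultimately show "a < ?n \<and> b < ?n"
      using less_mult_imp_div_less[of g ?n ?n] mod_less_divisor[of ?n g] by simp
  qed
  have "(a, b) \<in> hits t (?n * ?n) \<longleftrightarrow>
    (\<exists>g < ?n * ?n. g div ?n = a \<and> g mod ?n = b) \<and> candidate t a b \<and> reach t a b a b"
    unfolding hits_def reached_def by auto
  also have "\<dots> \<longleftrightarrow> a < ?n \<and> b < ?n \<and> proc (t ! a) = 0 \<and> predictable_race t (t ! a) (t ! b)"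
    unfolding idx[symmetric] using race[of a b] by (auto simp: candidate_def)
  finally show ?thesis .
qed

theorem corollary4p2:
  shows "\<exists>(A :: com) (d :: nat) (T :: nat \<Rightarrow> real).
    T \<in> O(\<lambda>n. real n ^ 4 * log 2 (real n)) \<and>
    (\<forall>(k :: nat) (V :: nat) (L :: nat) (t :: event list).
       k \<ge> 2 \<and> input_trace k V L t \<longrightarrow>
       (\<exists>R. computes_in A d k V L t (real k ^ 2 * real (max 1 V) * T (length t)) R \<and>
            sound_report t R \<and>
            (k = 2 \<longrightarrow> complete_report t R)))"
proof -
  define T where "T = (\<lambda>n. 1000 * real (Suc n) ^ 4)"
  have "T \<in> O(\<lambda>n. real n ^ 4 * log 2 (real n))"
  \<comment> \<open>16000 is 1000 times 16: for \<open>n >= 2\<close> the power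
    \<open>(n + 1)^4\<close> is at most \<open>(2 n)^4\<close>, and the logarithm is at least
    1.\<close>
  proof (rule bigoI[of _ 16000])
    show "\<forall>\<^sub>F n in at_top. norm (T n) \<le> 16000 * norm (real n ^ 4 * log 2 (real n))"
      using eventually_ge_at_top[of "2 :: nat"]
    proof eventually_elim
      case (elim n)
      have "real (Suc n) ^ 4 \<le> (2 * real n) ^ 4" using elim by (intro power_mono) simp_all
      also have "\<dots> = 16 * (real n ^ 4 * 1)" by (simp add: power_mult_distrib)
      also have "\<dots> \<le> 16 * (real n ^ 4 * log 2 (real n))"
        using elim by (intro mult_left_mono) (simp_all add: le_log_iff)
      finally have "T n \<le> 16000 * (real n ^ 4 * log 2 (real n))"
        by (simp add: T_def mult.commute)
      moreover have "0 \<le> T n" "0 \<le> log 2 (real n)" using elim by (simp_all add: T_def)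
      ultimately show ?case by simp
    qed
  qed
  moreover have "\<exists>R. computes_in race_program 3 k V L t (real k ^ 2 * real (max 1 V) * T (length t)) R \<and>
      sound_report t R \<and> (k = 2 \<longrightarrow> complete_report t R)"
    if k: "2 \<le> k" and t: "input_trace k V L t" for k V L t
  proof -
    have tr: "is_trace t" and p: "\<And>e. e \<in> set t \<Longrightarrow> proc e < k"
      using t by (auto simp: input_trace_def)
    have p2: "\<And>e. e \<in> set t \<Longrightarrow> proc e < 2" if "k = 2" using p that by blast
    obtain \<tau> s where ex: "exec (word_bound 3 k V L t) race_program (initial_state k V L t) \<tau> s"
      and \<tau>: "\<tau> \<le> 1000 * Suc (length t) ^ 4"
      and out: "if k = 2 then set (out s) = hits t (length t * length t) else out s = []"
      using run_race_program[OF k tr, of V L] bounded_initial[OF k t] unfolding run_def by blast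
    have "real \<tau> \<le> real (1000 * Suc (length t) ^ 4)" using \<tau> by (rule of_nat_mono)
    also have "\<dots> = 1 * 1 * T (length t)" by (simp add: T_def)
    also have "\<dots> \<le> real k ^ 2 * real (max 1 V) * T (length t)"
      using k by (intro mult_mono) (simp_all add: T_def one_le_power)
    finally have "computes_in race_program 3 k V L t
        (real k ^ 2 * real (max 1 V) * T (length t)) (out s)"
      unfolding computes_in_def using ex by blast
    moreover have "sound_report t (out s)"
    proof (cases "k = 2")
      case True
      then show ?thesis
        using out hits_iff[OF tr p2[OF True]] by (auto simp: sound_report_def)
    next
      case False
      then show ?thesis using out by (simp add: sound_report_def)
    qed
    moreover have "complete_report t (out s)" if k2: "k = 2"
      unfolding complete_report_def
    proof (intro allI impI)
      note hits = hits_iff[OF tr p2[OF k2]]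
      fix i j assume ij: "i < length t" "j < length t" and race: "predictable_race t (t ! i) (t ! j)"
      \<comment> \<open>The events of a race lie in different processes, so one of them is in
        process 0. The program reports that event first, and symmetry of races covers the case that
        it is \<open>t ! j\<close>.\<close>
      have "proc (t ! i) = 0 \<or> proc (t ! j) = 0"
        using race p2[OF k2, of "t ! i"] p2[OF k2, of "t ! j"] ij by (auto simp: predictable_race_def)
      then show "(i, j) \<in> set (out s) \<or> (j, i) \<in> set (out s)"
        using hits ij race out k2 predictable_race_sym by auto
    qed
    ultimately show ?thesis by blast
  qed
  ultimately show ?thesis by blast
qed

end
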